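(* Let $(X_i)_{i\ge1}$ be a reversible Markov chain on a measurable space $(E,\Sigma)$ which is uniformly ergodic (see context) with constants $m,\tau,\rho$ as in the context. Let $\mathcal H$ be a set of functions $E\times E\to\mathbb R$ such that $(\mathcal H,\|\cdot\|_\infty)$ is compact. Let $f:E\to\mathbb R$ and let $\ell$ be a pairwise loss of the form $$\ell(h,x_1,x_2)=\varphi\big(f(x_1)-f(x_2),\,h(x_1,x_2)\big),$$ where $\varphi:\mathbb R\times\mathbb R\to[0,1]$ is Lipschitz in its second variable with finite Lipschitz constant $\mathrm{Lip}(\varphi)$. Let $h_0,h_1,\dots,h_n\in\mathcal H$ be the hypotheses generated by an arbitrary online algorithm working with the loss $\ell$. Let $\xi>0$, $q=\frac{\xi+1}{\log(1/\rho)}$, $b_n=\lfloor q\log n\rfloor$, $c\in(0,1)$ and $c_n=\lceil cn\rceil$. Then for every $\epsilon=\epsilon_n>0$ with $\epsilon_n=o(n^\xi)$ as $n\to\infty$, for all sufficiently large $n$, $$\mathbb P\Big(\Big|\frac1{n-c_n}\sum_{t=c_n}^{n-1}\mathcal R(h_{t-b_n})-\mathcal M^n\Big|\ge\epsilon\Big)\le 2\Big[32\,\mathcal N\Big(\mathcal H,\frac{\epsilon}{8\,\mathrm{Lip}(\varphi)}\Big)+1\Big]\,b_n\,\exp\Big(-\frac{(c_n-b_n)\,C(m,\tau)\,\epsilon^2}{16\,b_n^2}\Big),$$ where $C(m,\tau)^{-1}=7\times10^3\times m^2\tau^2$.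
   Context: Online algorithm: for each $t$, $h_t\in\mathcal H$ is selected on the basis of the observations $(X_i,f(X_i))_{1\le i\le t}$, i.e. $h_t$ is $\sigma(X_1,\dots,X_t)$-measurable. Risk: $\mathcal R(h)=\mathbb E_{(X,X')\sim\pi\otimes\pi}[\ell(h,X,X')]$, where $\pi$ is the stationary distribution. Average paired empirical risk: $\mathcal M^n=\mathcal M^n(h_1,\dots,h_{n-1-b_n})=\frac1{n-c_n}\sum_{t=c_n}^{n-1}M_t$ with $M_t=\frac1{t-b_n}\sum_{i=1}^{t-b_n}\ell(h_{t-b_n},X_t,X_i)$; $n$ is assumed large enough that $c_n-b_n\ge1$. Covering number: $\mathcal N(\mathcal H,\eta)$ is the smallest cardinality of a set $\{g_1,\dots,g_N\}\subset\mathcal H$ such that every $h\in\mathcal H$ satisfies $\|g_i-h\|_\infty\le\eta$ for some $i$. Uniform ergodicity: with transition kernel $P$, the chain is $\psi$-irreducible for some maximal irreducibility measure $\psi$, and there exist an integer $m\ge1$, $\delta_m>0$ and a probability measure $\mu$ with $\delta_m\mu(A)\le P^m(x,A)$ for all $x\in E$, $A\in\Sigma$. Then there is a unique stationary distribution $\pi$ and there are constants $0<\rho<1$, $L>0$ with $\sup_{A\in\Sigma}|P^n(x,A)-\pi(A)|\le L\rho^n$ for all $n\ge0$ and $\pi$-a.e. $x$; such a $\rho$ is fixed. Constant $\tau$: consider the (Nummelin) split chain. On a possibly enlarged probability space, split time into consecutive blocks of $m$ steps and attach to the $k$-th block a variable $R_k\in\{0,1\}$ such that, given the past and the state $x$ at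 the beginning of the block, $R_k=1$ with probability $\delta_m$; if $R_k=1$ the state $m$ steps later is drawn from $\mu$, otherwise from $(P^m(x,\cdot)-\delta_m\mu)/(1-\delta_m)$, intermediate states being drawn from their conditional law, so that the marginal process is distributed as $(X_i)$. The regeneration times are $T_1=\inf\{k>0:R_k=1\}$ and $T_{i+1}=\inf\{k>0:R_{T_1+\dots+T_i+k}=1\}$. With $\|Y\|_{\psi_1}=\inf\{c>0:\mathbb E[\exp(|Y|/c)-1]\le1\}$, $\tau>0$ is a finite constant with $\|T_1\|_{\psi_1}\vee\|T_2\|_{\psi_1}\le\tau$. *)

theory Defs
  imports "HOL-Probability.Probability" "HOL-Library.Landau_Symbols"
begin

section \<open>Markov kernels and uniform ergodicity\<close>

text \<open>The measurable space $(E,\Sigma)$ is given by a measure \<open>S\<close> of which only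
  \<^term>\<open>space S\<close> and \<^term>\<open>sets S\<close> matter.\<close>

definition markov_kernel :: "'e measure \<Rightarrow> ('e \<Rightarrow> 'e measure) \<Rightarrow> bool" where
  "markov_kernel S P \<longleftrightarrow> P \<in> S \<rightarrow>\<^sub>M prob_algebra S"

primrec kernel_pow :: "'e measure \<Rightarrow> ('e \<Rightarrow> 'e measure) \<Rightarrow> nat \<Rightarrow> 'e \<Rightarrow> 'e measure" where
  "kernel_pow S P 0 x = return S x"
| "kernel_pow S P (Suc n) x = P x \<bind> kernel_pow S P n"

definition irreducibility_measure ::
  "'e measure \<Rightarrow> ('e \<Rightarrow> 'e measure) \<Rightarrow> 'e measure \<Rightarrow> bool" where
  "irreducibility_measure S P \<psi> \<longleftrightarrow>
     sets \<psi> = sets S \<and> 0 < emeasure \<psi> (space S) \<and>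
     (\<forall>A\<in>sets S. 0 < emeasure \<psi> A \<longrightarrow>
        (\<forall>x\<in>space S. \<exists>n\<ge>1. 0 < emeasure (kernel_pow S P n x) A))"

definition maximal_irreducibility_measure ::
  "'e measure \<Rightarrow> ('e \<Rightarrow> 'e measure) \<Rightarrow> 'e measure \<Rightarrow> bool" where
  "maximal_irreducibility_measure S P \<psi> \<longleftrightarrow>
     irreducibility_measure S P \<psi> \<and>
     (\<forall>\<nu>. irreducibility_measure S P \<nu> \<longrightarrow> absolutely_continuous \<psi> \<nu>)"

definition uniformly_ergodic ::
  "'e measure \<Rightarrow> ('e \<Rightarrow> 'e measure) \<Rightarrow> nat \<Rightarrow> real \<Rightarrow> 'e measure \<Rightarrow> bool" where
  "uniformly_ergodic S P m \<delta> \<mu> \<longleftrightarrow>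
     (\<exists>\<psi>. maximal_irreducibility_measure S P \<psi>) \<and>
     1 \<le> m \<and> 0 < \<delta> \<and> \<mu> \<in> space (prob_algebra S) \<and>
     (\<forall>x\<in>space S. \<forall>A\<in>sets S. \<delta> * measure \<mu> A \<le> measure (kernel_pow S P m x) A)"

definition stationary_distribution ::
  "'e measure \<Rightarrow> ('e \<Rightarrow> 'e measure) \<Rightarrow> 'e measure \<Rightarrow> bool" where
  "stationary_distribution S P \<pi> \<longleftrightarrow> \<pi> \<in> space (prob_algebra S) \<and> \<pi> \<bind> P = \<pi>"

text \<open>Detailed balance, $\pi(dx)P(x,dy) = \pi(dy)P(y,dx)$, tested on rectangles.\<close>

definition reversible_kernel ::
  "'e measure \<Rightarrow> ('e \<Rightarrow> 'e measure) \<Rightarrow> 'e measure \<Rightarrow> bool" where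
  "reversible_kernel S P \<pi> \<longleftrightarrow>
     (\<forall>A\<in>sets S. \<forall>B\<in>sets S.
        (\<integral>\<^sup>+x\<in>A. emeasure (P x) B \<partial>\<pi>) = (\<integral>\<^sup>+x\<in>B. emeasure (P x) A \<partial>\<pi>))"

definition ergodicity_rate ::
  "'e measure \<Rightarrow> ('e \<Rightarrow> 'e measure) \<Rightarrow> 'e measure \<Rightarrow> real \<Rightarrow> bool" where
  "ergodicity_rate S P \<pi> \<rho> \<longleftrightarrow>
     0 < \<rho> \<and> \<rho> < 1 \<and>
     (\<exists>L>0. AE x in \<pi>. \<forall>n. \<forall>A\<in>sets S.
        \<bar>measure (kernel_pow S P n x) A - measure \<pi> A\<bar> \<le> L * \<rho> ^ n)"


section \<open>Markov chains indexed from 1\<close>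

text \<open>The $\sigma$-algebra $\sigma(X_1,\dots,X_n)$ on the sample space; it is trivial for
  \<open>n = 0\<close>.\<close>

definition past :: "'w measure \<Rightarrow> 'e measure \<Rightarrow> (nat \<Rightarrow> 'w \<Rightarrow> 'e) \<Rightarrow> nat \<Rightarrow> 'w measure" where
  "past M S X n =
     vimage_algebra (space M) (\<lambda>\<omega>. \<lambda>i\<in>{1..n}. X i \<omega>) (PiM {1..n} (\<lambda>_. S))"

text \<open>The initial distribution is arbitrary.\<close>

definition markov_chain ::
  "'w measure \<Rightarrow> 'e measure \<Rightarrow> ('e \<Rightarrow> 'e measure) \<Rightarrow> (nat \<Rightarrow> 'w \<Rightarrow> 'e) \<Rightarrow> bool" where
  "markov_chain M S P X \<longleftrightarrow>
     prob_space M \<and> markov_kernel S P \<and> (\<forall>i\<ge>1. X i \<in> M \<rightarrow>\<^sub>M S) \<and>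
     (\<forall>n\<ge>1. \<forall>A\<in>sets S. AE \<omega> in M.
        real_cond_exp M (past M S X n) (\<lambda>\<omega>. indicator A (X (Suc n) \<omega>)) \<omega>
          = measure (P (X n \<omega>)) A)"

definition path_law :: "'w measure \<Rightarrow> 'e measure \<Rightarrow> (nat \<Rightarrow> 'w \<Rightarrow> 'e) \<Rightarrow> (nat \<Rightarrow> 'e) measure" where
  "path_law M S X = distr M (PiM {1..} (\<lambda>_. S)) (\<lambda>\<omega>. \<lambda>i\<in>{1..}. X i \<omega>)"


section \<open>The split chain and its regeneration times\<close>

text \<open>The $\sigma$-algebra generated by the $X_i$, $i \in I$, and the $R_k$, $k \in K$.\<close>

definition split_info ::
  "'w measure \<Rightarrow> 'e measure \<Rightarrow> (nat \<Rightarrow> 'w \<Rightarrow> 'e) \<Rightarrow> (nat \<Rightarrow> 'w \<Rightarrow> bool) \<Rightarrow>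
     nat set \<Rightarrow> nat set \<Rightarrow> 'w measure" where
  "split_info M S X R I K =
     vimage_algebra (space M) (\<lambda>\<omega>. (\<lambda>i\<in>I. X i \<omega>, \<lambda>k\<in>K. R k \<omega>))
       (PiM I (\<lambda>_. S) \<Otimes>\<^sub>M PiM K (\<lambda>_. count_space UNIV))"

text \<open>The \<open>k\<close>-th block (\<open>k \<ge> 1\<close>) starts in the state \<open>X s\<close>, \<open>s = (k - 1) * m + 1\<close>, and ends in
  the state \<open>X e\<close>, \<open>e = k * m + 1\<close>, which is also the first state of the next block; \<open>R k\<close>
  stands for $R_k = 1$. The three conditional laws are those of \<open>R k\<close> given the past; of
  \<open>X e\<close> given the past and \<open>R k\<close>; and of the intermediate states given all of this and \<open>X e\<close>.
  The last one is required to depend on the two end points only. Together with the requirement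
  that the path has the prescribed law \<open>Q\<close>, that of the original chain, this says that
  the intermediate states follow the conditional law of the chain given the end points, without
  presupposing a regular version of that law.
  For \<open>\<delta> = 1\<close> the quotient by \<open>1 - \<delta>\<close> is irrelevant, since then \<open>R k\<close> holds almost surely.\<close>

definition split_chain ::
  "'w measure \<Rightarrow> 'e measure \<Rightarrow> ('e \<Rightarrow> 'e measure) \<Rightarrow> nat \<Rightarrow> real \<Rightarrow> 'e measure \<Rightarrow>
     (nat \<Rightarrow> 'e) measure \<Rightarrow> (nat \<Rightarrow> 'w \<Rightarrow> 'e) \<Rightarrow> (nat \<Rightarrow> 'w \<Rightarrow> bool) \<Rightarrow> bool" where
  "split_chain M S P m \<delta> \<mu> Q X R \<longleftrightarrow>
     prob_space M \<and>
     (\<forall>i\<ge>1. X i \<in> M \<rightarrow>\<^sub>M S) \<and>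
     (\<forall>k\<ge>1. R k \<in> M \<rightarrow>\<^sub>M count_space UNIV) \<and>
     path_law M S X = Q \<and>
     (\<forall>k\<ge>1. let s = (k - 1) * m + 1; e = k * m + 1 in
        (AE \<omega> in M.
           real_cond_exp M (split_info M S X R {1..s} {1..<k}) (\<lambda>\<omega>. of_bool (R k \<omega>)) \<omega> = \<delta>) \<and>
        (\<forall>A\<in>sets S. AE \<omega> in M.
           real_cond_exp M (split_info M S X R {1..s} {1..k}) (\<lambda>\<omega>. indicator A (X e \<omega>)) \<omega>
             = (if R k \<omega> then measure \<mu> A
                else (measure (kernel_pow S P m (X s \<omega>)) A - \<delta> * measure \<mu> A) / (1 - \<delta>))) \<and>
        (\<forall>B\<in>sets (PiM {s<..<e} (\<lambda>_. S)). AE \<omega> in M.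
           real_cond_exp M (split_info M S X R ({1..s} \<union> {e}) {1..k})
               (\<lambda>\<omega>. indicator B (\<lambda>i\<in>{s<..<e}. X i \<omega>)) \<omega>
             = real_cond_exp M (split_info M S X R {s, e} {})
               (\<lambda>\<omega>. indicator B (\<lambda>i\<in>{s<..<e}. X i \<omega>)) \<omega>))"

text \<open>\<open>regen_epoch r i\<close> is $T_1 + \dots + T_i$ and \<open>regen_time r i\<close> is $T_i$ (for \<open>i \<ge> 1\<close>), for a
  realisation \<open>r\<close> of $(R_k)_k$. The infimum of the empty set is an arbitrary natural number, but
  along a split chain this case has probability zero.\<close>

primrec regen_epoch :: "(nat \<Rightarrow> bool) \<Rightarrow> nat \<Rightarrow> nat" where
  "regen_epoch r 0 = 0"
| "regen_epoch r (Suc i) = regen_epoch r i + Inf {k. 0 < k \<and> r (regen_epoch r i + k)}"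

definition regen_time :: "(nat \<Rightarrow> bool) \<Rightarrow> nat \<Rightarrow> nat" where
  "regen_time r i = Inf {k. 0 < k \<and> r (regen_epoch r (i - 1) + k)}"

definition psi1_norm :: "'w measure \<Rightarrow> ('w \<Rightarrow> real) \<Rightarrow> ereal" where
  "psi1_norm M Y =
     (INF c\<in>{c::real. 0 < c \<and> (\<integral>\<^sup>+\<omega>. ennreal (exp (\<bar>Y \<omega>\<bar> / c) - 1) \<partial>M) \<le> 1}. ereal c)"


section \<open>Hypothesis classes\<close>

text \<open>Functions $E \times E \to \mathbb{R}$ are represented by functions that are
  \<^term>\<open>undefined\<close> outside $E \times E$.\<close>

definition bounded_funs :: "'e set \<Rightarrow> ('e \<times> 'e \<Rightarrow> real) set" where
  "bounded_funs E = {g \<in> extensional (E \<times> E). bounded (g ` (E \<times> E))}"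

text \<open>The distance $\|g - h\|_\infty$, with the default value \<open>0\<close> outside the bounded
  functions that makes it an instance of \<^locale>\<open>Metric_space\<close>.\<close>

definition sup_dist :: "'e set \<Rightarrow> ('e \<times> 'e \<Rightarrow> real) \<Rightarrow> ('e \<times> 'e \<Rightarrow> real) \<Rightarrow> real" where
  "sup_dist E g h =
     (if g \<in> bounded_funs E \<and> h \<in> bounded_funs E then SUP z\<in>E \<times> E. \<bar>g z - h z\<bar> else 0)"

lemma Metric_space_sup_dist:
  assumes "E \<noteq> {}"
  shows "Metric_space (bounded_funs E) (sup_dist E)"
proof -
  have bdd: "bdd_above ((\<lambda>z. \<bar>g z - h z\<bar>) ` (E \<times> E))"
    if gh: "g \<in> bounded_funs E" "h \<in> bounded_funs E" for g h
  proof -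
    obtain a where a: "\<And>z. z \<in> E \<times> E \<Longrightarrow> \<bar>g z\<bar> \<le> a"
      using gh(1) unfolding bounded_funs_def bounded_iff by auto
    obtain b where b: "\<And>z. z \<in> E \<times> E \<Longrightarrow> \<bar>h z\<bar> \<le> b"
      using gh(2) unfolding bounded_funs_def bounded_iff by auto
    have "\<bar>g z - h z\<bar> \<le> a + b" if "z \<in> E \<times> E" for z
      using a[OF that] b[OF that] by linarith
    then show ?thesis by (intro bdd_aboveI2)
  qed
  have upper: "\<bar>g z - h z\<bar> \<le> sup_dist E g h"
    if "g \<in> bounded_funs E" "h \<in> bounded_funs E" "z \<in> E \<times> E" for g h z
    using cSUP_upper[OF that(3) bdd[OF that(1,2)]] that by (simp add: sup_dist_def)
  have least: "sup_dist E g h \<le> d"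
    if "g \<in> bounded_funs E" "h \<in> bounded_funs E" "\<And>z. z \<in> E \<times> E \<Longrightarrow> \<bar>g z - h z\<bar> \<le> d" for g h d
    using assms that by (auto simp: sup_dist_def intro!: cSUP_least)
  obtain x where x: "(x, x) \<in> E \<times> E" using assms by auto
  have nonneg: "0 \<le> sup_dist E g h" for g h
  proof (cases "g \<in> bounded_funs E \<and> h \<in> bounded_funs E")
    case True
    then show ?thesis using upper[of g h "(x, x)"] x by linarith
  qed (auto simp: sup_dist_def)
  have commute: "sup_dist E g h = sup_dist E h g" for g h
    by (simp add: sup_dist_def abs_minus_commute conj_commute)
  have zero: "sup_dist E g h = 0 \<longleftrightarrow> g = h"
    if gh: "g \<in> bounded_funs E" "h \<in> bounded_funs E" for g h
  proof
    assume "sup_dist E g h = 0"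
    then have "g z = h z" if "z \<in> E \<times> E" for z
      using upper[OF gh that] by simp
    then show "g = h"
      using gh by (intro extensionalityI[of _ "E \<times> E"]) (auto simp: bounded_funs_def)
  next
    assume "g = h"
    then show "sup_dist E g h = 0"
      using least[OF gh, of 0] nonneg[of g h] by simp
  qed
  have triangle: "sup_dist E g k \<le> sup_dist E g h + sup_dist E h k"
    if ghk: "g \<in> bounded_funs E" "h \<in> bounded_funs E" "k \<in> bounded_funs E" for g h k
  proof (rule least[OF ghk(1,3)])
    fix z assume z: "z \<in> E \<times> E"
    show "\<bar>g z - k z\<bar> \<le> sup_dist E g h + sup_dist E h k"
      using upper[OF ghk(1,2) z] upper[OF ghk(2,3) z] by linarith
  qed
  show ?thesis
    by unfold_locales (use nonneg commute zero triangle in auto)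
qed

definition sup_topology :: "'e set \<Rightarrow> ('e \<times> 'e \<Rightarrow> real) topology" where
  "sup_topology E = Metric_space.mtopology (bounded_funs E) (sup_dist E)"

definition hyp_borel :: "'e set \<Rightarrow> ('e \<times> 'e \<Rightarrow> real) set \<Rightarrow> ('e \<times> 'e \<Rightarrow> real) measure" where
  "hyp_borel E H = sigma H {U. openin (subtopology (sup_topology E) H) U}"

text \<open>The radius is extended real, so that a radius $\epsilon / (8\,\mathrm{Lip}(\varphi))$ is
  infinite when the Lipschitz constant is zero. The cover is required to be finite because the
  cardinality of an infinite set is \<open>0\<close>.\<close>

definition covering_number :: "'e set \<Rightarrow> ('e \<times> 'e \<Rightarrow> real) set \<Rightarrow> ereal \<Rightarrow> nat" where
  "covering_number E H \<eta> =
     Inf {card G | G. finite G \<and> G \<subseteq> H \<and> (\<forall>h\<in>H. \<exists>g\<in>G. ereal (sup_dist E g h) \<le> \<eta>)}"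


section \<open>Pairwise losses and online learning\<close>

definition lipschitz_snd :: "(real \<Rightarrow> real \<Rightarrow> real) \<Rightarrow> bool" where
  "lipschitz_snd \<phi> \<longleftrightarrow> (\<exists>K. \<forall>u. K-lipschitz_on UNIV (\<phi> u))"

definition Lip :: "(real \<Rightarrow> real \<Rightarrow> real) \<Rightarrow> real" where
  "Lip \<phi> = Inf {K. \<forall>u. K-lipschitz_on UNIV (\<phi> u)}"

definition pair_loss ::
  "(real \<Rightarrow> real \<Rightarrow> real) \<Rightarrow> ('e \<Rightarrow> real) \<Rightarrow> ('e \<times> 'e \<Rightarrow> real) \<Rightarrow> 'e \<Rightarrow> 'e \<Rightarrow> real" where
  "pair_loss \<phi> f h x1 x2 = \<phi> (f x1 - f x2) (h (x1, x2))"

definition risk ::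
  "'e measure \<Rightarrow> (('e \<times> 'e \<Rightarrow> real) \<Rightarrow> 'e \<Rightarrow> 'e \<Rightarrow> real) \<Rightarrow> ('e \<times> 'e \<Rightarrow> real) \<Rightarrow> real" where
  "risk \<pi> l h = (\<integral>(x, x'). l h x x' \<partial>(\<pi> \<Otimes>\<^sub>M \<pi>))"

text \<open>The selected hypothesis \<open>h t\<close> is a random element of \<open>H\<close>, with the Borel
  $\sigma$-algebra of the supremum norm, that is measurable with respect to
  $\sigma(X_1,\dots,X_t)$.\<close>

definition online_hypotheses ::
  "'w measure \<Rightarrow> 'e measure \<Rightarrow> (nat \<Rightarrow> 'w \<Rightarrow> 'e) \<Rightarrow> ('e \<times> 'e \<Rightarrow> real) set \<Rightarrow> nat \<Rightarrow>
     (nat \<Rightarrow> 'w \<Rightarrow> 'e \<times> 'e \<Rightarrow> real) \<Rightarrow> bool" where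
  "online_hypotheses M S X H n h \<longleftrightarrow>
     (\<forall>t\<le>n. h t \<in> past M S X t \<rightarrow>\<^sub>M hyp_borel (space S) H)"

definition paired_risk ::
  "(('e \<times> 'e \<Rightarrow> real) \<Rightarrow> 'e \<Rightarrow> 'e \<Rightarrow> real) \<Rightarrow> (nat \<Rightarrow> 'w \<Rightarrow> 'e) \<Rightarrow>
     (nat \<Rightarrow> 'w \<Rightarrow> 'e \<times> 'e \<Rightarrow> real) \<Rightarrow> nat \<Rightarrow> nat \<Rightarrow> 'w \<Rightarrow> real" where
  "paired_risk l X h b t \<omega> =
     1 / real (t - b) * (\<Sum>i=1..t - b. l (h (t - b) \<omega>) (X t \<omega>) (X i \<omega>))"

definition avg_paired_risk ::
  "(('e \<times> 'e \<Rightarrow> real) \<Rightarrow> 'e \<Rightarrow> 'e \<Rightarrow> real) \<Rightarrow> (nat \<Rightarrow> 'w \<Rightarrow> 'e) \<Rightarrow>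
     (nat \<Rightarrow> 'w \<Rightarrow> 'e \<times> 'e \<Rightarrow> real) \<Rightarrow> nat \<Rightarrow> nat \<Rightarrow> nat \<Rightarrow> 'w \<Rightarrow> real" where
  "avg_paired_risk l X h b c n \<omega> =
     1 / (real n - real c) * (\<Sum>t=c..<n. paired_risk l X h b t \<omega>)"

definition burn_in :: "real \<Rightarrow> real \<Rightarrow> nat \<Rightarrow> nat" where
  "burn_in \<xi> \<rho> n = nat \<lfloor>(\<xi> + 1) / ln (1 / \<rho>) * ln (real n)\<rfloor>"

definition start_time :: "real \<Rightarrow> nat \<Rightarrow> nat" where
  "start_time c n = nat \<lceil>c * real n\<rceil>"

definition rate_const :: "nat \<Rightarrow> real \<Rightarrow> real" where
  "rate_const m \<tau> = 1 / (7 * 10 ^ 3 * (real m)\<^sup>2 * \<tau>\<^sup>2)"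

end

(* Since b_n tends to infinity like log n, every constant in the exponent is slack: it suffices to
   have concentration with an exponent of order n * epsilon^2 / b_n.
   Doeblin's condition contracts oscillations by 1 - delta every m steps, so the solutions of the
   Poisson equation are bounded by m / delta; with Azuma's inequality this gives concentration of
   empirical means of a fixed function, for every initial distribution. Predicting X_t from time
   t - b_n replaces M_t by such a mean for the random hypothesis h_(t-b_n), up to an error
   L * rho^(b_n), which is negligible off a pi-null set that the chain visits with exponentially small
   probability; a finite cover of H handles the dependence of the hypothesis on the sample. The
   prediction errors form, along each residue class of t modulo b_n, a martingale difference
   sequence. *)
theory Submission
  imports Defs "HOL-Real_Asymp.Real_Asymp"
begin

section \<open>Contraction of Doeblin kernels and the Poisson equation\<close>

text \<open>For large n the target is at least 1 unless its exponent \<open>Z\<close> is at least 1,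
  and \<open>Z \<ge> 1\<close> forces \<epsilon> to be at least of order b / sqrt n. Every error
  that must stay below a fraction of \<epsilon> is compared with this threshold. The two mixing
  estimates have different tasks. The lag \<open>b\<close> is calibrated to \<rho>, which makes
  \<open>L * \<rho> ^ b\<close> O(1/n), well below the threshold; the Doeblin bound
  \<open>(1 - \<delta>) ^ (b div m)\<close> might only be a small power of 1/n. Conversely the rate
  \<rho> is available only from \<pi>-almost every state, and an arbitrary initial law may charge
  the exceptional set, while the Doeblin bound holds from every state; it controls the visits to
  that set and the solutions of the Poisson equation. The union bound over the times costs ln n in
  the exponent. It is affordable because the concentration exponent is \<open>Z\<close> times a
  factor of order b^2, hence of order (ln n)^2; the size of the cover is already a factor of the
  target.\<close>

lemma integrable_bounded_prob:
  fixes g :: "'a \<Rightarrow> real"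
  assumes "\<nu> \<in> space (prob_algebra S)" "g \<in> borel_measurable S" "\<And>y. y \<in> space S \<Longrightarrow> g y \<in> {lo..hi}"
  shows "integrable \<nu> g" "(\<integral>y. g y \<partial>\<nu>) \<in> {lo..hi}"
proof -
  interpret prob_space \<nu> using assms(1) by (simp add: space_prob_algebra)
  have sets: "sets \<nu> = sets S" using assms(1) by (simp add: space_prob_algebra)
  have space: "space \<nu> = space S" using sets by (rule sets_eq_imp_space_eq)
  have "g \<in> borel_measurable \<nu>" using assms(2) sets by (simp cong: measurable_cong_sets)
  then show int: "integrable \<nu> g"
    by (rule integrable_const_bound[where B="max \<bar>lo\<bar> \<bar>hi\<bar>", rotated])
       (use assms(3) space in \<open>fastforce intro!: AE_I2\<close>)
  have "lo \<le> (\<integral>y. g y \<partial>\<nu>)"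
    by (rule integral_ge_const[OF int]) (use assms(3) space in \<open>force intro!: AE_I2\<close>)
  moreover have "(\<integral>y. g y \<partial>\<nu>) \<le> hi"
    by (rule integral_le_const[OF int]) (use assms(3) space in \<open>force intro!: AE_I2\<close>)
  ultimately show "(\<integral>y. g y \<partial>\<nu>) \<in> {lo..hi}" by simp
qed

section \<open>Integration against the iterates of a Markov kernel\<close>

locale markov_kernel_on =
  fixes S :: "'e measure" and P :: "'e \<Rightarrow> 'e measure"
  assumes kernel: "markov_kernel S P"
begin

lemma kernel_pow_measurable: "kernel_pow S P n \<in> S \<rightarrow>\<^sub>M prob_algebra S"
proof (induction n)
  case 0
  have "return S \<in> S \<rightarrow>\<^sub>M prob_algebra S"
    by (rule measurable_return_prob_space)
  then show ?case by (subst measurable_cong[where g="return S"]) auto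
next
  case (Suc n)
  have "(\<lambda>x. P x \<bind> kernel_pow S P n) \<in> S \<rightarrow>\<^sub>M prob_algebra S"
    using kernel[unfolded markov_kernel_def] Suc
    by (rule measurable_bind_prob_space)
  then show ?case by (subst measurable_cong[where g="\<lambda>x. P x \<bind> kernel_pow S P n"]) auto
qed

lemma P_measurable: "P \<in> S \<rightarrow>\<^sub>M prob_algebra S"
  using kernel unfolding markov_kernel_def .

lemma kernel_pow_in_prob_algebra:
  "x \<in> space S \<Longrightarrow> kernel_pow S P n x \<in> space (prob_algebra S)"
  using measurable_space[OF kernel_pow_measurable] .

lemma prob_space_kernel_pow: "x \<in> space S \<Longrightarrow> prob_space (kernel_pow S P n x)"
  and sets_kernel_pow: "x \<in> space S \<Longrightarrow> sets (kernel_pow S P n x) = sets S"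
  and space_kernel_pow: "x \<in> space S \<Longrightarrow> space (kernel_pow S P n x) = space S"
  using kernel_pow_in_prob_algebra[of x n] sets_eq_imp_space_eq[of "kernel_pow S P n x" S]
  by (auto simp: space_prob_algebra)

definition kernel_int :: "nat \<Rightarrow> ('e \<Rightarrow> real) \<Rightarrow> 'e \<Rightarrow> real" where
  "kernel_int n g x = (\<integral>y. g y \<partial>kernel_pow S P n x)"

lemma kernel_int_measurable [measurable]:
  assumes "g \<in> borel_measurable S"
  shows "kernel_int n g \<in> borel_measurable S"
  unfolding kernel_int_def
  by (rule measurable_compose[OF measurable_prob_algebraD[OF kernel_pow_measurable]
        integral_measurable_subprob_algebra[OF assms]])

lemma kernel_int_bounds:
  assumes "g \<in> borel_measurable S" "\<And>y. y \<in> space S \<Longrightarrow> g y \<in> {lo..hi}" "x \<in> space S"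
  shows "kernel_int n g x \<in> {lo..hi}"
  unfolding kernel_int_def
  using integrable_bounded_prob(2)[OF kernel_pow_in_prob_algebra[OF assms(3)] assms(1,2)] by simp

lemma integral_bind_kernel:
  assumes \<nu>: "\<nu> \<in> space (prob_algebra S)" and K: "K \<in> S \<rightarrow>\<^sub>M prob_algebra S"
    and g: "g \<in> borel_measurable S" "\<And>y. y \<in> space S \<Longrightarrow> g y \<in> {lo..hi::real}"
  shows "(\<integral>y. g y \<partial>(\<nu> \<bind> K)) = (\<integral>x. (\<integral>y. g y \<partial>K x) \<partial>\<nu>)"
proof (rule integral_bind)
  show "K \<in> \<nu> \<rightarrow>\<^sub>M subprob_algebra S"
    using measurable_prob_algebraD[OF K] \<nu> by (simp add: space_prob_algebra cong: measurable_cong_sets)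
  show "g \<in> borel_measurable S" by (rule g)
  show "\<And>x. x \<in> space S \<Longrightarrow> \<bar>g x\<bar> \<le> max \<bar>lo\<bar> \<bar>hi\<bar>" using g(2) by fastforce
  show "finite_measure \<nu>" using \<nu> by (simp add: space_prob_algebra prob_space.finite_measure)
  show "AE x in \<nu>. emeasure (K x) (space (K x)) \<le> ennreal 1"
  proof (rule AE_I2)
    fix x assume "x \<in> space \<nu>"
    then have "x \<in> space S"
      using \<nu> sets_eq_imp_space_eq[of \<nu> S] by (simp add: space_prob_algebra)
    then have "prob_space (K x)" using measurable_space[OF K] by (simp add: space_prob_algebra)
    then show "emeasure (K x) (space (K x)) \<le> ennreal 1" by (simp add: prob_space.emeasure_space_1)
  qed
qed

lemma kernel_int_0: "g \<in> borel_measurable S \<Longrightarrow> x \<in> space S \<Longrightarrow> kernel_int 0 g x = g x"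
  unfolding kernel_int_def by (simp add: integral_return)

lemma kernel_int_Suc:
  assumes "g \<in> borel_measurable S" "\<And>y. y \<in> space S \<Longrightarrow> g y \<in> {lo..hi}" "x \<in> space S"
  shows "kernel_int (Suc n) g x = (\<integral>y. kernel_int n g y \<partial>P x)"
  unfolding kernel_int_def
  using integral_bind_kernel[OF measurable_space[OF P_measurable assms(3)] kernel_pow_measurable assms(1,2)]
  by simp

lemma kernel_int_add:
  assumes "g \<in> borel_measurable S" "\<And>y. y \<in> space S \<Longrightarrow> g y \<in> {lo..hi}" "x \<in> space S"
  shows "kernel_int (i + j) g x = kernel_int i (kernel_int j g) x"
  using assms(3)
proof (induction i arbitrary: x)
  case 0
  then show ?case by (simp add: kernel_int_0 kernel_int_measurable[OF assms(1)])
next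
  case (Suc i)
  have sp: "space (P x) = space S"
    using measurable_space[OF P_measurable Suc.prems] sets_eq_imp_space_eq
    by (auto simp: space_prob_algebra)
  have "kernel_int (Suc i + j) g x = (\<integral>y. kernel_int (i + j) g y \<partial>P x)"
    using kernel_int_Suc[OF assms(1,2) Suc.prems, of "i + j"] by simp
  also have "\<dots> = (\<integral>y. kernel_int i (kernel_int j g) y \<partial>P x)"
    using Suc.IH sp by (intro Bochner_Integration.integral_cong) auto
  also have "\<dots> = kernel_int (Suc i) (kernel_int j g) x"
    using kernel_int_Suc[OF kernel_int_measurable[OF assms(1)] kernel_int_bounds[OF assms(1,2)] Suc.prems]
    by simp
  finally show ?case .
qed

lemma stationary_pow:
  assumes "stationary_distribution S P \<pi>"
  shows "\<pi> \<bind> kernel_pow S P n = \<pi>"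
proof -
  have \<pi>: "sets \<pi> = sets S" "\<pi> \<bind> P = \<pi>" "space \<pi> = space S"
    using assms sets_eq_imp_space_eq[of \<pi> S]
    by (auto simp: stationary_distribution_def space_prob_algebra)
  show ?thesis
  proof (induction n)
    case 0
    have "\<pi> \<bind> kernel_pow S P 0 = \<pi> \<bind> return S" by (intro bind_cong) auto
    then show ?case using bind_return''[OF \<pi>(1)] by simp
  next
    case (Suc n)
    have m: "P \<in> \<pi> \<rightarrow>\<^sub>M subprob_algebra S"
      using measurable_prob_algebraD[OF P_measurable] \<pi>(1) by (simp cong: measurable_cong_sets)
    have "\<pi> \<bind> kernel_pow S P (Suc n) = \<pi> \<bind> (\<lambda>x. P x \<bind> kernel_pow S P n)"
      by (intro bind_cong) auto
    also have "\<dots> = (\<pi> \<bind> P) \<bind> kernel_pow S P n"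
      using bind_assoc[OF m measurable_prob_algebraD[OF kernel_pow_measurable]] by simp
    finally show ?case unfolding \<pi>(2) Suc .
  qed
qed

lemma integral_stationary:
  assumes "stationary_distribution S P \<pi>"
    and "g \<in> borel_measurable S" "\<And>y. y \<in> space S \<Longrightarrow> g y \<in> {lo..hi}"
  shows "(\<integral>x. kernel_int n g x \<partial>\<pi>) = (\<integral>x. g x \<partial>\<pi>)"
  unfolding kernel_int_def
  using integral_bind_kernel[OF _ kernel_pow_measurable assms(2,3), of \<pi> n] assms(1)
    stationary_pow[OF assms(1), of n]
  by (simp add: stationary_distribution_def)

end

section \<open>Doeblin's minorisation: contraction and mixing from every state\<close>

locale doeblin_kernel = markov_kernel_on S P for S :: "'e measure" and P +
  fixes m :: nat and \<delta> :: real and \<mu> \<pi> :: "'e measure"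
  assumes ergodic: "uniformly_ergodic S P m \<delta> \<mu>"
    and stationary: "stationary_distribution S P \<pi>"
begin

lemma m_pos: "1 \<le> m" and \<delta>_pos: "0 < \<delta>" and \<mu>: "\<mu> \<in> space (prob_algebra S)"
  and minorisation: "x \<in> space S \<Longrightarrow> A \<in> sets S \<Longrightarrow> \<delta> * measure \<mu> A \<le> measure (kernel_pow S P m x) A"
  using ergodic by (auto simp: uniformly_ergodic_def)

lemma \<pi>: "\<pi> \<in> space (prob_algebra S)"
  using stationary by (simp add: stationary_distribution_def)

lemma space_nonempty: "space S \<noteq> {}"
  using \<mu> prob_space.not_empty[of \<mu>] sets_eq_imp_space_eq[of \<mu> S] by (auto simp: space_prob_algebra)

lemma \<delta>_le_1: "\<delta> \<le> 1"
proof -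
  obtain x where x: "x \<in> space S" using space_nonempty by auto
  interpret \<mu>: prob_space \<mu> using \<mu> by (simp add: space_prob_algebra)
  interpret px: prob_space "kernel_pow S P m x" using prob_space_kernel_pow[OF x] .
  have "space \<mu> = space S" using \<mu> sets_eq_imp_space_eq[of \<mu> S] by (auto simp: space_prob_algebra)
  then have "measure \<mu> (space S) = 1" using \<mu>.prob_space by simp
  then show ?thesis
    using order_trans[OF minorisation[OF x, of "space S"] px.prob_le_1] by simp
qed

text \<open>Setwise domination of \<delta>\<mu> by the m-step law is an inequality between measures,
  which integration of nonnegative functions preserves; this is why the range of \<open>g\<close>
  starts at 0.\<close>

lemma minorisation_integral:
  assumes g: "g \<in> borel_measurable S" "\<And>y. y \<in> space S \<Longrightarrow> g y \<in> {0..hi}" and x: "x \<in> space S"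
  shows "\<delta> * (\<integral>y. g y \<partial>\<mu>) \<le> kernel_int m g x"
proof -
  let ?p = "kernel_pow S P m x"
  interpret \<mu>: prob_space \<mu> using \<mu> by (simp add: space_prob_algebra)
  interpret px: prob_space ?p using prob_space_kernel_pow[OF x] .
  have sets: "sets \<mu> = sets S" "space \<mu> = space S" "sets ?p = sets S" "space ?p = space S"
    using \<mu> sets_eq_imp_space_eq[of \<mu> S] sets_kernel_pow[OF x] space_kernel_pow[OF x]
    by (auto simp: space_prob_algebra)
  have le: "scale_measure (ennreal \<delta>) \<mu> \<le> ?p"
  proof (rule less_eq_measure.intros(3))
    show "sets (scale_measure (ennreal \<delta>) \<mu>) = sets ?p" using sets by simp
    show "emeasure (scale_measure (ennreal \<delta>) \<mu>) \<le> emeasure ?p"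
    proof (rule le_funI)
      fix A
      show "emeasure (scale_measure (ennreal \<delta>) \<mu>) A \<le> emeasure ?p A"
      proof (cases "A \<in> sets S")
        case True
        have "ennreal \<delta> * emeasure \<mu> A = ennreal (\<delta> * measure \<mu> A)"
          using \<delta>_pos by (simp add: \<mu>.emeasure_eq_measure ennreal_mult)
        also have "\<dots> \<le> ennreal (measure ?p A)"
          using minorisation[OF x True] by (rule ennreal_leI)
        finally show ?thesis by (simp add: px.emeasure_eq_measure)
      qed (use sets in \<open>auto simp: emeasure_notin_sets\<close>)
    qed
    show "space (scale_measure (ennreal \<delta>) \<mu>) = space ?p" using sets by (simp add: space_scale_measure)
  qed
  have gm: "g \<in> borel_measurable \<mu>" using g(1) sets by (simp cong: measurable_cong_sets)
  have "ennreal \<delta> * (\<integral>\<^sup>+y. ennreal (g y) \<partial>\<mu>) = (\<integral>\<^sup>+y. ennreal (g y) \<partial>scale_measure (ennreal \<delta>) \<mu>)"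
    using gm by (subst nn_integral_scale_measure) auto
  also have "\<dots> \<le> (\<integral>\<^sup>+y. ennreal (g y) \<partial>?p)"
    using sets le by (intro nn_integral_mono_measure) auto
  finally have *: "ennreal \<delta> * (\<integral>\<^sup>+y. ennreal (g y) \<partial>\<mu>) \<le> (\<integral>\<^sup>+y. ennreal (g y) \<partial>?p)" .
  have 1: "(\<integral>\<^sup>+y. ennreal (g y) \<partial>\<mu>) = ennreal (\<integral>y. g y \<partial>\<mu>)"
    by (intro nn_integral_eq_integral AE_I2 integrable_bounded_prob(1)[OF \<mu> g])
       (use g(2) sets in auto)
  have 2: "(\<integral>\<^sup>+y. ennreal (g y) \<partial>?p) = ennreal (\<integral>y. g y \<partial>?p)"
    by (intro nn_integral_eq_integral AE_I2
          integrable_bounded_prob(1)[OF kernel_pow_in_prob_algebra[OF x] g])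
       (use g(2) sets in auto)
  have 3: "0 \<le> (\<integral>y. g y \<partial>?p)"
    using integrable_bounded_prob(2)[OF kernel_pow_in_prob_algebra[OF x] g] by simp
  have 4: "0 \<le> (\<integral>y. g y \<partial>\<mu>)"
    using integrable_bounded_prob(2)[OF \<mu> g] by simp
  show ?thesis
    using * 3 4 \<delta>_pos unfolding 1 2 kernel_int_def by (simp flip: ennreal_mult)
qed

text \<open>The m-step law is \<delta>\<mu> plus a remainder of mass 1 - \<delta>, and the first
  part contributes the same constant from every state. The remainder is never constructed: the
  minorisation is applied to the two nonnegative functions \<open>g - lo\<close> and
  \<open>lo + w - g\<close>, which gives the two ends of the smaller interval.\<close>

lemma kernel_int_contraction:
  assumes g: "g \<in> borel_measurable S" "\<And>y. y \<in> space S \<Longrightarrow> g y \<in> {lo..lo + w}"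
  obtains lo' where "\<And>x. x \<in> space S \<Longrightarrow> kernel_int m g x \<in> {lo'..lo' + (1 - \<delta>) * w}"
proof
  fix x assume x: "x \<in> space S"
  interpret \<mu>: prob_space \<mu> using \<mu> by (simp add: space_prob_algebra)
  interpret px: prob_space "kernel_pow S P m x" using prob_space_kernel_pow[OF x] .
  have b: "g y - lo \<in> {0..w}" "lo + w - g y \<in> {0..w}" if "y \<in> space S" for y
    using g(2)[OF that] by auto
  have int: "integrable \<mu> g" "integrable (kernel_pow S P m x) g"
    using integrable_bounded_prob(1)[OF _ g] \<mu> kernel_pow_in_prob_algebra[OF x] by auto
  have "\<delta> * (\<integral>y. g y - lo \<partial>\<mu>) \<le> kernel_int m (\<lambda>y. g y - lo) x"
    by (rule minorisation_integral[where hi=w]) (use g(1) b x in auto)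
  also have "kernel_int m (\<lambda>y. g y - lo) x = kernel_int m g x - lo"
    unfolding kernel_int_def using int by (simp add: px.prob_space)
  finally have 1: "\<delta> * ((\<integral>y. g y \<partial>\<mu>) - lo) \<le> kernel_int m g x - lo"
    using int by (simp add: \<mu>.prob_space)
  have "\<delta> * (\<integral>y. lo + w - g y \<partial>\<mu>) \<le> kernel_int m (\<lambda>y. lo + w - g y) x"
    by (rule minorisation_integral[where hi=w]) (use g(1) b x in auto)
  also have "kernel_int m (\<lambda>y. lo + w - g y) x = lo + w - kernel_int m g x"
    unfolding kernel_int_def using int by (simp add: px.prob_space)
  finally have 2: "\<delta> * (lo + w - (\<integral>y. g y \<partial>\<mu>)) \<le> lo + w - kernel_int m g x"
    using int by (simp add: \<mu>.prob_space)
  show "kernel_int m g x \<in> {lo + \<delta> * ((\<integral>y. g y \<partial>\<mu>) - lo)..(lo + \<delta> * ((\<integral>y. g y \<partial>\<mu>) - lo)) + (1 - \<delta>) * w}"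
    using 1 2 by (simp add: algebra_simps)
qed

text \<open>Each further block of m steps, put in front, shrinks the range by the factor 1 -
  \<delta>; the \<open>j\<close> steps next to \<open>g\<close> only average and cost
  nothing.\<close>

lemma kernel_int_oscillation:
  assumes g: "g \<in> borel_measurable S" "\<And>y. y \<in> space S \<Longrightarrow> g y \<in> {0..1}"
  shows "\<exists>lo. \<forall>x\<in>space S. kernel_int (m * i + j) g x \<in> {lo..lo + (1 - \<delta>) ^ i}"
proof (induction i)
  case 0
  have "\<forall>x\<in>space S. kernel_int j g x \<in> {0..1}"
    using kernel_int_bounds[OF g] by blast
  then show ?case by (intro exI[of _ 0]) simp
next
  case (Suc i)
  then obtain lo where lo: "\<And>x. x \<in> space S \<Longrightarrow> kernel_int (m * i + j) g x \<in> {lo..lo + (1 - \<delta>) ^ i}" by blast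
  obtain lo' where lo':
    "\<And>x. x \<in> space S \<Longrightarrow> kernel_int m (kernel_int (m * i + j) g) x \<in> {lo'..lo' + (1 - \<delta>) * (1 - \<delta>) ^ i}"
    using kernel_int_contraction[OF kernel_int_measurable[OF g(1)] lo] by blast
  have Suc_eq: "m * Suc i + j = m + (m * i + j)" by simp
  have "kernel_int (m * Suc i + j) g x = kernel_int m (kernel_int (m * i + j) g) x"
    if "x \<in> space S" for x
    unfolding Suc_eq by (rule kernel_int_add[OF g that])
  then show ?case using lo' by (intro exI[of _ lo']) simp
qed

text \<open>Integrating \<open>kernel_int n g\<close> against \<pi> gives back the mean of
  \<open>g\<close>, so this mean lies in the same short interval as all the values. The estimate
  holds from every state, unlike \<open>ergodicity_rate\<close>.\<close>

lemma kernel_int_stationary_dist: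
  assumes g: "g \<in> borel_measurable S" "\<And>y. y \<in> space S \<Longrightarrow> g y \<in> {0..1}" and x: "x \<in> space S"
  shows "\<bar>kernel_int n g x - (\<integral>y. g y \<partial>\<pi>)\<bar> \<le> (1 - \<delta>) ^ (n div m)"
proof -
  obtain lo where "\<forall>x\<in>space S. kernel_int (m * (n div m) + n mod m) g x \<in> {lo..lo + (1 - \<delta>) ^ (n div m)}"
    using kernel_int_oscillation[OF g] by blast
  then have lo: "\<And>x. x \<in> space S \<Longrightarrow> kernel_int n g x \<in> {lo..lo + (1 - \<delta>) ^ (n div m)}" by simp
  have "(\<integral>y. kernel_int n g y \<partial>\<pi>) \<in> {lo..lo + (1 - \<delta>) ^ (n div m)}"
    by (rule integrable_bounded_prob(2)[OF \<pi> kernel_int_measurable[OF g(1)] lo])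
  then show ?thesis using lo[OF x] integral_stationary[OF stationary g, of n] by auto
qed

text \<open>The indicator of \<open>N\<close> has mean 0 under \<pi>. This will control the visits
  to the exceptional set of \<open>ergodicity_rate\<close>.\<close>

lemma kernel_pow_null_set:
  assumes N: "N \<in> null_sets \<pi>" and x: "x \<in> space S"
  shows "measure (kernel_pow S P n x) N \<le> (1 - \<delta>) ^ (n div m)"
proof -
  have sets: "sets \<pi> = sets S" using \<pi> by (simp add: space_prob_algebra)
  have N': "N \<in> sets S" using N sets by auto
  have "\<bar>kernel_int n (indicator N) x - (\<integral>y. indicator N y \<partial>\<pi>)\<bar> \<le> (1 - \<delta>) ^ (n div m)"
    by (rule kernel_int_stationary_dist) (use N' x in \<open>auto simp: indicator_def\<close>)
  moreover have "(\<integral>y. indicator N y \<partial>\<pi>) = (0::real)"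
    using N by (simp add: null_setsD1 measure_eq_0_null_sets)
  moreover have "kernel_int n (indicator N) x = measure (kernel_pow S P n x) N"
    unfolding kernel_int_def using N' sets_kernel_pow[OF x] by simp
  ultimately show ?thesis by (simp add: measure_def)
qed

section \<open>Bounded approximate solutions of the Poisson equation\<close>

lemma sum_contraction_le: "(\<Sum>j<n. (1 - \<delta>) ^ (j div m)) \<le> real m / \<delta>"
proof -
  have d: "0 \<le> 1 - \<delta>" "1 - \<delta> < 1" using \<delta>_le_1 \<delta>_pos by auto
  \<comment> \<open>Passing to \<open>n * m\<close> terms completes the blocks: each value of
    \<open>j div m\<close> then occurs exactly \<open>m\<close> times, and the sum is
    \<open>m\<close> times a geometric one.\<close>
  have "(\<Sum>j<n. (1 - \<delta>) ^ (j div m)) \<le> (\<Sum>j<n * m. (1 - \<delta>) ^ (j div m))"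
    using m_pos d by (intro sum_mono2) auto
  also have "\<dots> = (\<Sum>i<n. \<Sum>j=i*m..<i*m+m. (1 - \<delta>) ^ (j div m))"
    by (rule sum.nat_group[symmetric])
  also have "\<dots> = (\<Sum>i<n. \<Sum>j=i*m..<i*m+m. (1 - \<delta>) ^ i)"
  proof (intro sum.cong refl)
    fix i j assume "j \<in> {i*m..<i*m+m}"
    then have "j div m = i" by (intro div_nat_eqI) (auto simp: mult.commute)
    then show "(1 - \<delta>) ^ (j div m) = (1 - \<delta>) ^ i" by simp
  qed
  also have "\<dots> = real m * (\<Sum>i<n. (1 - \<delta>) ^ i)" by (simp add: sum_distrib_left)
  also have "\<dots> \<le> real m * (1 / \<delta>)"
    using d \<delta>_pos by (intro mult_left_mono) (auto simp: sum_gp_strict field_simps)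
  finally show ?thesis by simp
qed

text \<open>The solution of the Poisson equation is the full series. The partial sum avoids the
  question of convergence, at the price of the remainder in \<open>poisson_equation\<close>, which
  is as small as desired for large \<open>J\<close>.\<close>

definition poisson :: "nat \<Rightarrow> ('e \<Rightarrow> real) \<Rightarrow> 'e \<Rightarrow> real" where
  "poisson J g x = (\<Sum>j<J. kernel_int j g x - (\<integral>y. g y \<partial>\<pi>))"

lemma poisson_measurable [measurable]:
  "g \<in> borel_measurable S \<Longrightarrow> poisson J g \<in> borel_measurable S"
  unfolding poisson_def
  by (intro borel_measurable_sum borel_measurable_diff measurable_const kernel_int_measurable) auto

lemma poisson_bound:
  assumes "g \<in> borel_measurable S" "\<And>y. y \<in> space S \<Longrightarrow> g y \<in> {0..1}" "x \<in> space S"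
  shows "\<bar>poisson J g x\<bar> \<le> real m / \<delta>"
proof -
  have "\<bar>poisson J g x\<bar> \<le> (\<Sum>j<J. (1 - \<delta>) ^ (j div m))"
    unfolding poisson_def using kernel_int_stationary_dist[OF assms]
    by (intro order_trans[OF sum_abs] sum_mono)
  then show ?thesis using sum_contraction_le[of J] by linarith
qed

text \<open>Applying the kernel shifts the index of each summand by one, so the difference
  telescopes; its last term is the remainder.\<close>

lemma poisson_equation:
  assumes g: "g \<in> borel_measurable S" "\<And>y. y \<in> space S \<Longrightarrow> g y \<in> {0..1}" and x: "x \<in> space S"
  shows "g x - (\<integral>y. g y \<partial>\<pi>) =
    poisson J g x - kernel_int 1 (poisson J g) x + (kernel_int J g x - (\<integral>y. g y \<partial>\<pi>))"
proof -
  let ?I = "\<integral>y. g y \<partial>\<pi>"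
  interpret px: prob_space "kernel_pow S P (Suc 0) x" using prob_space_kernel_pow[OF x] .
  have int: "integrable (kernel_pow S P (Suc 0) x) (kernel_int j g)" for j
    using integrable_bounded_prob(1)[OF kernel_pow_in_prob_algebra[OF x] kernel_int_measurable[OF g(1)]
        kernel_int_bounds[OF g]] by blast
  have "kernel_int 1 (poisson J g) x = (\<Sum>j<J. kernel_int 1 (kernel_int j g) x - ?I)"
    unfolding kernel_int_def[of 1] poisson_def using int
    by (subst Bochner_Integration.integral_sum) (auto simp: px.prob_space simp del: kernel_pow.simps)
  also have "\<dots> = (\<Sum>j<J. kernel_int (Suc j) g x - ?I)"
    using kernel_int_add[OF g x, of 1] by simp
  finally have "poisson J g x - kernel_int 1 (poisson J g) x
      = (\<Sum>j<J. kernel_int j g x - kernel_int (Suc j) g x)"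
    by (simp add: poisson_def sum_subtractf)
  also have "\<dots> = kernel_int 0 g x - kernel_int J g x" by (rule sum_lessThan_telescope')
  finally show ?thesis using kernel_int_0[OF g(1) x] by simp
qed

end

section \<open>Lagged prediction along a Markov chain\<close>

locale observed_chain =
  fixes M :: "'w measure" and S :: "'e measure" and P :: "'e \<Rightarrow> 'e measure" and X :: "nat \<Rightarrow> 'w \<Rightarrow> 'e"
  assumes chain: "markov_chain M S P X"
begin

sublocale prob_space M
  using chain by (simp add: markov_chain_def)

sublocale markov_kernel_on S P
  by unfold_locales (use chain in \<open>simp add: markov_chain_def\<close>)

lemma X_measurable: "1 \<le> i \<Longrightarrow> X i \<in> M \<rightarrow>\<^sub>M S"
  using chain by (simp add: markov_chain_def)

lemma space_past [simp]: "space (past M S X n) = space M"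
  by (simp add: past_def)

lemma subalgebra_past: "subalgebra M (past M S X n)"
  unfolding subalgebra_def
proof
  show "sets (past M S X n) \<subseteq> sets M" unfolding past_def
    by (rule sets_image_in_sets) (auto intro!: measurable_restrict X_measurable)
qed simp

lemma X_past_measurable:
  assumes "1 \<le> i" "i \<le> n"
  shows "X i \<in> past M S X n \<rightarrow>\<^sub>M S"
proof -
  have "(\<lambda>\<omega>. \<lambda>i\<in>{1..n}. X i \<omega>) \<in> past M S X n \<rightarrow>\<^sub>M PiM {1..n} (\<lambda>_. S)"
    unfolding past_def
    by (rule measurable_vimage_algebra1)
       (auto simp: space_PiM intro!: measurable_space[OF X_measurable])
  then have "(\<lambda>\<omega>. (\<lambda>i\<in>{1..n}. X i \<omega>) i) \<in> past M S X n \<rightarrow>\<^sub>M S"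
    by (rule measurable_compose[OF _ measurable_component_singleton]) (use assms in simp)
  then show ?thesis using assms by (simp add: cong: measurable_cong)
qed

lemma past_mono: "k \<le> n \<Longrightarrow> sets (past M S X k) \<subseteq> sets (past M S X n)"
  unfolding past_def[of M S X k]
  by (rule sets_image_in_sets) (auto intro!: measurable_restrict X_past_measurable)

lemma measurable_past_mono:
  "k \<le> n \<Longrightarrow> f \<in> past M S X k \<rightarrow>\<^sub>M N \<Longrightarrow> f \<in> past M S X n \<rightarrow>\<^sub>M N"
  using past_mono[of k n] by (auto simp: measurable_def)

lemma measurable_past: "f \<in> past M S X k \<rightarrow>\<^sub>M N \<Longrightarrow> f \<in> M \<rightarrow>\<^sub>M N"
  by (rule measurable_from_subalg[OF subalgebra_past])

lemma measurable_pair_past_mono: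
  assumes "k \<le> n" "f \<in> past M S X k \<Otimes>\<^sub>M L \<rightarrow>\<^sub>M N"
  shows "f \<in> past M S X n \<Otimes>\<^sub>M L \<rightarrow>\<^sub>M N"
proof -
  have "(\<lambda>z. (fst z, snd z)) \<in> past M S X n \<Otimes>\<^sub>M L \<rightarrow>\<^sub>M past M S X k \<Otimes>\<^sub>M L"
    by (intro measurable_Pair measurable_snd measurable_compose[OF measurable_fst]
        measurable_past_mono[OF assms(1)] measurable_ident_sets[OF refl])
  from measurable_compose[OF this assms(2)] show ?thesis by simp
qed

text \<open>\<open>markov_chain\<close> gives, for each fixed \<open>B\<close>, an identity outside
  a null set depending on \<open>B\<close>. Integrated over an event of the past it becomes an exact
  statement on rectangles, from which \<open>one_step_kernel\<close> recovers the whole joint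
  law.\<close>

lemma one_step_event:
  assumes n: "1 \<le> n" and A: "A \<in> sets (past M S X n)" and B: "B \<in> sets S"
  shows "emeasure M (A \<inter> {\<omega> \<in> space M. X (Suc n) \<omega> \<in> B})
    = (\<integral>\<^sup>+\<omega>. indicator A \<omega> * emeasure (P (X n \<omega>)) B \<partial>M)"
proof -
  let ?F = "past M S X n"
  interpret F: finite_measure_subalgebra M ?F
    by unfold_locales (rule subalgebra_past)
  have AM: "A \<in> sets M" using A subalgebra_past[of n] by (auto simp: subalgebra_def)
  have [measurable]: "X n \<in> M \<rightarrow>\<^sub>M S" "X (Suc n) \<in> M \<rightarrow>\<^sub>M S" using n by (auto intro: X_measurable)
  have ind: "(\<lambda>\<omega>. indicator B (X (Suc n) \<omega>) :: real) \<in> borel_measurable M"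
    using B by measurable
  have int: "integrable M (\<lambda>\<omega>. indicator B (X (Suc n) \<omega>) :: real)"
    by (rule integrable_const_bound[where B=1]) (use ind in \<open>auto simp: indicator_def\<close>)
  have C: "A \<inter> {\<omega> \<in> space M. X (Suc n) \<omega> \<in> B} \<in> sets M"
    using AM B by (intro sets.Int) (auto intro!: measurable_sets_Collect[of "\<lambda>\<omega>. X (Suc n) \<omega>"])
  have PXm: "(\<lambda>\<omega>. measure (P (X n \<omega>)) B) \<in> borel_measurable M"
    using B by (intro measurable_compose[OF \<open>X n \<in> M \<rightarrow>\<^sub>M S\<close>]
        measurable_compose[OF measurable_prob_algebraD[OF P_measurable]] measurable_measure_subprob_algebra)
  have Pprob: "prob_space (P (X n \<omega>))" if "\<omega> \<in> space M" for \<omega>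
    using measurable_space[OF P_measurable measurable_space[OF \<open>X n \<in> M \<rightarrow>\<^sub>M S\<close> that]]
    by (simp add: space_prob_algebra)
  have "measure M (A \<inter> {\<omega> \<in> space M. X (Suc n) \<omega> \<in> B})
      = (\<integral>\<omega>. indicator (A \<inter> {\<omega> \<in> space M. X (Suc n) \<omega> \<in> B}) \<omega> \<partial>M)"
    using C by simp
  also have "\<dots> = (\<integral>\<omega>\<in>A. indicator B (X (Suc n) \<omega>) \<partial>M)"
    unfolding set_lebesgue_integral_def
    by (intro Bochner_Integration.integral_cong) (auto simp: indicator_def)
  also have "\<dots> = (\<integral>\<omega>\<in>A. real_cond_exp M ?F (\<lambda>\<omega>. indicator B (X (Suc n) \<omega>)) \<omega> \<partial>M)"
    by (rule F.real_cond_exp_intA[OF int A])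
  also have "\<dots> = (\<integral>\<omega>\<in>A. measure (P (X n \<omega>)) B \<partial>M)"
  proof (rule set_lebesgue_integral_cong_AE)
    show "AE \<omega>\<in>A in M. real_cond_exp M ?F (\<lambda>\<omega>. indicator B (X (Suc n) \<omega>)) \<omega> = measure (P (X n \<omega>)) B"
    proof -
      have "AE \<omega> in M. real_cond_exp M ?F (\<lambda>\<omega>. indicator B (X (Suc n) \<omega>)) \<omega> = measure (P (X n \<omega>)) B"
        using chain n B unfolding markov_chain_def by blast
      then show ?thesis by (rule eventually_mono) simp
    qed
  qed (use AM PXm in auto)
  finally have eq: "measure M (A \<inter> {\<omega> \<in> space M. X (Suc n) \<omega> \<in> B})
      = (\<integral>\<omega>. indicator A \<omega> * measure (P (X n \<omega>)) B \<partial>M)"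
    by (simp add: set_lebesgue_integral_def)
  have "(\<integral>\<^sup>+\<omega>. indicator A \<omega> * emeasure (P (X n \<omega>)) B \<partial>M)
      = (\<integral>\<^sup>+\<omega>. ennreal (indicator A \<omega> * measure (P (X n \<omega>)) B) \<partial>M)"
    using finite_measure.emeasure_eq_measure[OF prob_space.finite_measure[OF Pprob]]
    by (intro nn_integral_cong) (auto simp: indicator_def)
  also have "\<dots> = ennreal (\<integral>\<omega>. indicator A \<omega> * measure (P (X n \<omega>)) B \<partial>M)"
  proof (rule nn_integral_eq_integral)
    show "integrable M (\<lambda>\<omega>. indicator A \<omega> * measure (P (X n \<omega>)) B)"
      by (rule integrable_const_bound[where B=1])
         (use AM PXm prob_space.prob_le_1[OF Pprob] in \<open>auto intro!: AE_I2 simp: indicator_def\<close>)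
  qed auto
  finally show ?thesis using eq by (simp add: emeasure_eq_measure)
qed

text \<open>Integrands such as the loss of a random hypothesis depend jointly on the past and on the
  new state. The joint law of the two is identified on the rectangles, an intersection-stable
  generator.\<close>

lemma one_step_kernel:
  assumes n: "1 \<le> n" and G: "G \<in> borel_measurable (past M S X n \<Otimes>\<^sub>M S)"
  shows "(\<integral>\<^sup>+\<omega>. G (\<omega>, X (Suc n) \<omega>) \<partial>M) = (\<integral>\<^sup>+\<omega>. (\<integral>\<^sup>+y. G (\<omega>, y) \<partial>P (X n \<omega>)) \<partial>M)"
proof -
  let ?F = "past M S X n"
  \<comment> \<open>\<open>?R\<close> carries the \<sigma>-algebra for which \<open>?K\<close> is a
    kernel. \<open>?K \<omega>\<close> is the one-step law moved to the fibre over \<omega>, so that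
    the bind of the two is a law on the product.\<close>
  let ?R = "restr_to_subalg M ?F"
  let ?K = "\<lambda>\<omega>. distr (P (X n \<omega>)) (?F \<Otimes>\<^sub>M S) (Pair \<omega>)"
  let ?J = "distr M (?F \<Otimes>\<^sub>M S) (\<lambda>\<omega>. (\<omega>, X (Suc n) \<omega>))"
  note subalg = subalgebra_past[of n]
  have setsR: "sets ?R = sets ?F" by (rule sets_restr_to_subalg[OF subalg])
  have Xn: "X n \<in> ?F \<rightarrow>\<^sub>M S" using n by (intro X_past_measurable) auto
  have pair: "(\<lambda>\<omega>. (\<omega>, X (Suc n) \<omega>)) \<in> M \<rightarrow>\<^sub>M ?F \<Otimes>\<^sub>M S"
    by (intro measurable_Pair measurable_past[OF measurable_ident_sets[OF refl]] X_measurable) simp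
  have PX: "(\<lambda>\<omega>. P (X n \<omega>)) \<in> ?F \<rightarrow>\<^sub>M subprob_algebra S"
    by (rule measurable_compose[OF Xn measurable_prob_algebraD[OF P_measurable]])
  have K: "?K \<in> ?F \<rightarrow>\<^sub>M subprob_algebra (?F \<Otimes>\<^sub>M S)"
    by (rule measurable_distr2[OF _ PX]) simp
  have KR: "?K \<in> ?R \<rightarrow>\<^sub>M subprob_algebra (?F \<Otimes>\<^sub>M S)"
    using K setsR by (simp cong: measurable_cong_sets)
  have setsP: "sets (P (X n \<omega>)) = sets S" "space (P (X n \<omega>)) = space S" if "\<omega> \<in> space M" for \<omega>
    using subprob_measurableD[OF PX] that by auto
  have Pairm: "Pair \<omega> \<in> P (X n \<omega>) \<rightarrow>\<^sub>M ?F \<Otimes>\<^sub>M S" if "\<omega> \<in> space M" for \<omega>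
    using setsP[OF that] that by (simp cong: measurable_cong_sets)
  have eq: "?J = ?R \<bind> ?K"
  proof (rule measure_eqI_generator_eq[OF Int_stable_pair_measure_generator pair_measure_closed,
        where A="\<lambda>_. space ?F \<times> space S"])
    show "sets ?J = sigma_sets (space ?F \<times> space S) {a \<times> b |a b. a \<in> sets ?F \<and> b \<in> sets S}"
      by (simp add: sets_pair_measure)
    have "sets (?R \<bind> ?K) = sets (?F \<Otimes>\<^sub>M S)"
      by (rule sets_bind[OF sets_kernel[OF KR]]) (auto simp: space_restr_to_subalg not_empty)
    then show "sets (?R \<bind> ?K) = sigma_sets (space ?F \<times> space S) {a \<times> b |a b. a \<in> sets ?F \<and> b \<in> sets S}"
      by (simp add: sets_pair_measure)
    show "range (\<lambda>_. space ?F \<times> space S) \<subseteq> {a \<times> b |a b. a \<in> sets ?F \<and> b \<in> sets S}" by blast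
    show "(\<Union>i. space ?F \<times> space S) = space ?F \<times> space S" by simp
    interpret J: prob_space ?J by (rule prob_space_distr[OF pair])
    show "emeasure ?J (space ?F \<times> space S) \<noteq> \<infinity>"
      by (rule J.emeasure_finite[unfolded infinity_ennreal_def[symmetric]])
    fix C assume "C \<in> {a \<times> b |a b. a \<in> sets ?F \<and> b \<in> sets S}"
    then obtain A B where C: "C = A \<times> B" "A \<in> sets ?F" "B \<in> sets S" by blast
    have AM: "A \<subseteq> space M" using sets.sets_into_space[OF C(2)] by simp
    have "emeasure ?J C = emeasure M (A \<inter> {\<omega> \<in> space M. X (Suc n) \<omega> \<in> B})"
      using C AM pair by (subst emeasure_distr) (auto intro!: arg_cong[where f="emeasure M"])
    also have "\<dots> = (\<integral>\<^sup>+\<omega>. indicator A \<omega> * emeasure (P (X n \<omega>)) B \<partial>M)"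
      by (rule one_step_event[OF n C(2,3)])
    also have "\<dots> = (\<integral>\<^sup>+\<omega>. indicator A \<omega> * emeasure (P (X n \<omega>)) B \<partial>?R)"
      using C PX by (intro nn_integral_subalgebra2[OF subalg, symmetric] borel_measurable_times_ennreal
          borel_measurable_indicator measurable_compose[OF PX measurable_emeasure_subprob_algebra]) auto
    also have "\<dots> = (\<integral>\<^sup>+\<omega>. emeasure (?K \<omega>) C \<partial>?R)"
    proof (rule nn_integral_cong)
      fix \<omega> assume "\<omega> \<in> space ?R"
      then have \<omega>: "\<omega> \<in> space M" by (simp add: space_restr_to_subalg)
      have "emeasure (?K \<omega>) C = emeasure (P (X n \<omega>)) (Pair \<omega> -` C \<inter> space (P (X n \<omega>)))"
        using C Pairm[OF \<omega>] by (subst emeasure_distr) auto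
      also have "Pair \<omega> -` C \<inter> space (P (X n \<omega>)) = (if \<omega> \<in> A then B else {})"
        using C sets.sets_into_space[OF C(3)] setsP[OF \<omega>] by auto
      finally show "indicator A \<omega> * emeasure (P (X n \<omega>)) B = emeasure (?K \<omega>) C" by simp
    qed
    also have "\<dots> = emeasure (?R \<bind> ?K) C"
      by (rule emeasure_bind[OF _ KR, symmetric]) (use C in \<open>auto simp: space_restr_to_subalg not_empty\<close>)
    finally show "emeasure ?J C = emeasure (?R \<bind> ?K) C" .
  qed
  have "(\<integral>\<^sup>+\<omega>. G (\<omega>, X (Suc n) \<omega>) \<partial>M) = (\<integral>\<^sup>+z. G z \<partial>?J)"
    by (rule nn_integral_distr[OF pair, symmetric]) (use G in simp)
  also have "\<dots> = (\<integral>\<^sup>+\<omega>. (\<integral>\<^sup>+z. G z \<partial>?K \<omega>) \<partial>?R)"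
    unfolding eq by (rule nn_integral_bind[OF G KR])
  also have "\<dots> = (\<integral>\<^sup>+\<omega>. (\<integral>\<^sup>+z. G z \<partial>?K \<omega>) \<partial>M)"
    by (rule nn_integral_subalgebra2[OF subalg])
       (rule measurable_compose[OF K nn_integral_measurable_subprob_algebra[OF G]])
  also have "\<dots> = (\<integral>\<^sup>+\<omega>. (\<integral>\<^sup>+y. G (\<omega>, y) \<partial>P (X n \<omega>)) \<partial>M)"
    by (intro nn_integral_cong nn_integral_distr[OF Pairm]) (use G in auto)
  finally show ?thesis .
qed

text \<open>The induction keeps \<open>G\<close> and moves the time: \<open>G\<close> is also
  measurable for the larger past at \<open>Suc n\<close>, so the induction hypothesis integrates out
  the last \<open>b\<close> steps from there, and \<open>one_step_kernel\<close> the remaining first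
  one.\<close>

lemma lagged_kernel:
  assumes "1 \<le> n" and "G \<in> borel_measurable (past M S X n \<Otimes>\<^sub>M S)"
  shows "(\<integral>\<^sup>+\<omega>. G (\<omega>, X (n + b) \<omega>) \<partial>M)
    = (\<integral>\<^sup>+\<omega>. (\<integral>\<^sup>+y. G (\<omega>, y) \<partial>kernel_pow S P b (X n \<omega>)) \<partial>M)"
  using assms
proof (induction b arbitrary: n)
  case 0
  have "(\<integral>\<^sup>+y. G (\<omega>, y) \<partial>return S (X n \<omega>)) = G (\<omega>, X n \<omega>)" if "\<omega> \<in> space M" for \<omega>
    using that measurable_space[OF X_measurable[OF 0(1)] that]
    by (intro nn_integral_return measurable_compose[OF _ 0(2)] measurable_Pair) auto
  then show ?case by (auto intro!: nn_integral_cong)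
next
  case (Suc b)
  let ?G = "\<lambda>(\<omega>, z). \<integral>\<^sup>+y. G (\<omega>, y) \<partial>kernel_pow S P b z"
  have G'[measurable]: "?G \<in> borel_measurable (past M S X n \<Otimes>\<^sub>M S)"
  proof -
    have "(\<lambda>z. \<integral>\<^sup>+y. (\<lambda>z y. G (fst z, y)) z y \<partial>kernel_pow S P b (snd z))
        \<in> borel_measurable (past M S X n \<Otimes>\<^sub>M S)"
    proof (rule nn_integral_measurable_subprob_algebra2)
      show "(\<lambda>z. kernel_pow S P b (snd z)) \<in> past M S X n \<Otimes>\<^sub>M S \<rightarrow>\<^sub>M subprob_algebra S"
        by (rule measurable_compose[OF measurable_snd measurable_prob_algebraD[OF kernel_pow_measurable]])
      show "(\<lambda>(z, y). G (fst z, y)) \<in> borel_measurable ((past M S X n \<Otimes>\<^sub>M S) \<Otimes>\<^sub>M S)"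
        unfolding split_beta' by (rule measurable_compose[OF _ Suc.prems(2)]) measurable
    qed
    then show ?thesis by (simp add: split_beta')
  qed
  have "(\<integral>\<^sup>+\<omega>. G (\<omega>, X (n + Suc b) \<omega>) \<partial>M) = (\<integral>\<^sup>+\<omega>. ?G (\<omega>, X (Suc n) \<omega>) \<partial>M)"
    using Suc.IH[of "Suc n"] measurable_pair_past_mono[OF _ Suc.prems(2), of "Suc n"] by simp
  also have "\<dots> = (\<integral>\<^sup>+\<omega>. (\<integral>\<^sup>+z. ?G (\<omega>, z) \<partial>P (X n \<omega>)) \<partial>M)"
    by (rule one_step_kernel[OF Suc.prems(1) G'])
  also have "\<dots> = (\<integral>\<^sup>+\<omega>. (\<integral>\<^sup>+y. G (\<omega>, y) \<partial>kernel_pow S P (Suc b) (X n \<omega>)) \<partial>M)"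
  proof (rule nn_integral_cong)
    fix \<omega> assume \<omega>: "\<omega> \<in> space M"
    have x: "X n \<omega> \<in> space S" using measurable_space[OF X_measurable[OF Suc.prems(1)] \<omega>] .
    have "sets (P (X n \<omega>)) = sets S"
      using measurable_space[OF P_measurable x] by (simp add: space_prob_algebra)
    then have K: "kernel_pow S P b \<in> P (X n \<omega>) \<rightarrow>\<^sub>M subprob_algebra S"
      using measurable_prob_algebraD[OF kernel_pow_measurable] by (simp cong: measurable_cong_sets)
    have "(\<lambda>y. G (\<omega>, y)) \<in> borel_measurable S"
      using \<omega> by (intro measurable_compose[OF _ Suc.prems(2)]) auto
    from nn_integral_bind[OF this K]
    show "(\<integral>\<^sup>+z. ?G (\<omega>, z) \<partial>P (X n \<omega>)) = (\<integral>\<^sup>+y. G (\<omega>, y) \<partial>kernel_pow S P (Suc b) (X n \<omega>))"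
      by simp
  qed
  finally show ?case .
qed

section \<open>Prediction errors and their exponential tails\<close>

lemma measurable_kernel_integral:
  fixes \<Phi> :: "'a \<times> 'e \<Rightarrow> real"
  assumes \<Phi>: "\<Phi> \<in> borel_measurable (F \<Otimes>\<^sub>M S)" and K: "K \<in> F \<rightarrow>\<^sub>M subprob_algebra S"
  shows "(\<lambda>\<omega>. \<integral>y. \<Phi> (\<omega>, y) \<partial>K \<omega>) \<in> borel_measurable F"
proof -
  \<comment> \<open>Moving the kernel to the fibre over \<omega> makes the integrand the fixed
    function \<open>\<Phi>\<close>; what remains is measurability of integration as a map on
    measures.\<close>
  have m: "(\<lambda>\<omega>. \<integral>z. \<Phi> z \<partial>distr (K \<omega>) (F \<Otimes>\<^sub>M S) (Pair \<omega>)) \<in> borel_measurable F"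
    by (rule measurable_compose[OF measurable_distr2[OF _ K] integral_measurable_subprob_algebra[OF \<Phi>]]) simp
  show ?thesis
  proof (rule measurable_cong[THEN iffD1, OF _ m])
    fix \<omega> assume \<omega>: "\<omega> \<in> space F"
    have "Pair \<omega> \<in> K \<omega> \<rightarrow>\<^sub>M F \<Otimes>\<^sub>M S"
      using subprob_measurableD(2)[OF K \<omega>] \<omega> by (simp cong: measurable_cong_sets)
    then show "(\<integral>z. \<Phi> z \<partial>distr (K \<omega>) (F \<Otimes>\<^sub>M S) (Pair \<omega>)) = (\<integral>y. \<Phi> (\<omega>, y) \<partial>K \<omega>)"
      by (rule integral_distr[OF _ \<Phi>])
  qed
qed

text \<open>The error in predicting \<open>\<Phi> (\<omega>, X (n + b) \<omega>)\<close> from time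
  \<open>n\<close>. When \<open>\<Phi>\<close> depends on \<omega> through the past at
  \<open>n\<close> only, the subtracted term is the conditional expectation given that past.\<close>

definition innovation :: "nat \<Rightarrow> ('w \<times> 'e \<Rightarrow> real) \<Rightarrow> nat \<Rightarrow> 'w \<Rightarrow> real" where
  "innovation b \<Phi> n \<omega> = \<Phi> (\<omega>, X (n + b) \<omega>) - kernel_int b (\<lambda>y. \<Phi> (\<omega>, y)) (X n \<omega>)"

lemma compensator_measurable:
  assumes "1 \<le> n" "\<Phi> \<in> borel_measurable (past M S X n \<Otimes>\<^sub>M S)"
  shows "(\<lambda>\<omega>. kernel_int b (\<lambda>y. \<Phi> (\<omega>, y)) (X n \<omega>)) \<in> borel_measurable (past M S X n)"
  unfolding kernel_int_def using assms
  by (intro measurable_kernel_integral measurable_compose[OF X_past_measurable]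
      measurable_prob_algebraD kernel_pow_measurable) auto

lemma innovation_measurable:
  assumes n: "1 \<le> n" and \<Phi>: "\<Phi> \<in> borel_measurable (past M S X n \<Otimes>\<^sub>M S)"
  shows "innovation b \<Phi> n \<in> borel_measurable (past M S X (n + b))"
  unfolding innovation_def
proof (rule borel_measurable_diff)
  show "(\<lambda>\<omega>. \<Phi> (\<omega>, X (n + b) \<omega>)) \<in> borel_measurable (past M S X (n + b))"
    by (intro measurable_compose[OF _ measurable_pair_past_mono[of n "n + b", OF le_add1 \<Phi>]] measurable_Pair
        X_past_measurable measurable_ident_sets[OF refl]) (use n in auto)
  show "(\<lambda>\<omega>. kernel_int b (\<lambda>y. \<Phi> (\<omega>, y)) (X n \<omega>)) \<in> borel_measurable (past M S X (n + b))"
    by (rule measurable_past_mono[OF _ compensator_measurable[OF n \<Phi>]]) simp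
qed

text \<open>Hoeffding's lemma, conditionally on the past: with \<omega> frozen,
  \<open>\<Phi> (\<omega>, y)\<close> ranges over an interval of length \<open>w\<close> and is
  centred by its mean under the b-step law, while \<open>Y\<close> factors out as a
  constant.\<close>

lemma innovation_mgf:
  assumes n: "1 \<le> n" and \<Phi>: "\<Phi> \<in> borel_measurable (past M S X n \<Otimes>\<^sub>M S)"
    and bound: "\<And>\<omega> y. \<omega> \<in> space M \<Longrightarrow> y \<in> space S \<Longrightarrow> \<Phi> (\<omega>, y) \<in> {lo..lo + w}"
    and Y: "Y \<in> borel_measurable (past M S X n)" and l: "0 < l"
  shows "(\<integral>\<^sup>+\<omega>. ennreal (exp (l * (Y \<omega> + innovation b \<Phi> n \<omega>))) \<partial>M)
    \<le> ennreal (exp (l\<^sup>2 * w\<^sup>2 / 8)) * (\<integral>\<^sup>+\<omega>. ennreal (exp (l * Y \<omega>)) \<partial>M)"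
proof -
  let ?k = "\<lambda>\<omega>. kernel_int b (\<lambda>y. \<Phi> (\<omega>, y)) (X n \<omega>)"
  let ?G = "\<lambda>z. ennreal (exp (l * (Y (fst z) + (\<Phi> z - ?k (fst z)))))"
  note k = compensator_measurable[OF n \<Phi>, of b]
  have G: "?G \<in> borel_measurable (past M S X n \<Otimes>\<^sub>M S)"
    using Y \<Phi> k by measurable
  have "(\<integral>\<^sup>+\<omega>. ennreal (exp (l * (Y \<omega> + innovation b \<Phi> n \<omega>))) \<partial>M) = (\<integral>\<^sup>+\<omega>. ?G (\<omega>, X (n + b) \<omega>) \<partial>M)"
    by (simp add: innovation_def)
  also have "\<dots> = (\<integral>\<^sup>+\<omega>. (\<integral>\<^sup>+y. ?G (\<omega>, y) \<partial>kernel_pow S P b (X n \<omega>)) \<partial>M)"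
    by (rule lagged_kernel[OF n G])
  also have "\<dots> \<le> (\<integral>\<^sup>+\<omega>. ennreal (exp (l\<^sup>2 * w\<^sup>2 / 8)) * ennreal (exp (l * Y \<omega>)) \<partial>M)"
  proof (rule nn_integral_mono)
    fix \<omega> assume \<omega>: "\<omega> \<in> space M"
    have x: "X n \<omega> \<in> space S" using measurable_space[OF X_measurable[OF n] \<omega>] .
    let ?K = "kernel_pow S P b (X n \<omega>)"
    have m: "(\<lambda>y. \<Phi> (\<omega>, y)) \<in> borel_measurable ?K"
      using \<omega> measurable_compose[OF measurable_Pair1' \<Phi>, of \<omega>] sets_kernel_pow[OF x]
      by (simp cong: measurable_cong_sets)
    interpret K: interval_bounded_random_variable ?K "\<lambda>y. \<Phi> (\<omega>, y)" lo "lo + w"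
      using prob_space_kernel_pow[OF x] m bound[OF \<omega>] space_kernel_pow[OF x]
      by (intro interval_bounded_random_variable.intro interval_bounded_random_variable_axioms.intro AE_I2) auto
    have "(\<integral>\<^sup>+y. ?G (\<omega>, y) \<partial>?K)
        = (\<integral>\<^sup>+y. ennreal (exp (l * Y \<omega>)) * ennreal (exp (l * (\<Phi> (\<omega>, y) - ?k \<omega>))) \<partial>?K)"
      by (simp add: distrib_left exp_add ennreal_mult)
    also have "\<dots> = ennreal (exp (l * Y \<omega>)) * (\<integral>\<^sup>+y. ennreal (exp (l * (\<Phi> (\<omega>, y) - ?k \<omega>))) \<partial>?K)"
      using m by (intro nn_integral_cmult) measurable
    also have "\<dots> \<le> ennreal (exp (l * Y \<omega>)) * ennreal (exp (l\<^sup>2 * w\<^sup>2 / 8))"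
      using K.Hoeffdings_lemma_nn_integral[OF l] by (intro mult_left_mono) (auto simp: kernel_int_def)
    finally show "(\<integral>\<^sup>+y. ?G (\<omega>, y) \<partial>?K) \<le> ennreal (exp (l\<^sup>2 * w\<^sup>2 / 8)) * ennreal (exp (l * Y \<omega>))"
      by (simp add: mult.commute)
  qed
  also have "\<dots> = ennreal (exp (l\<^sup>2 * w\<^sup>2 / 8)) * (\<integral>\<^sup>+\<omega>. ennreal (exp (l * Y \<omega>)) \<partial>M)"
    using measurable_past[OF Y] by (intro nn_integral_cmult) measurable
  finally show ?thesis .
qed

lemma innovation_sum_measurable:
  assumes u: "1 \<le> u" and \<Phi>: "\<And>j. j < k \<Longrightarrow> \<Phi> j \<in> borel_measurable (past M S X (u + j * b) \<Otimes>\<^sub>M S)"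
  shows "(\<lambda>\<omega>. \<Sum>j<k. innovation b (\<Phi> j) (u + j * b) \<omega>) \<in> borel_measurable (past M S X (u + k * b))"
proof (rule borel_measurable_sum)
  fix j assume "j \<in> {..<k}"
  then have j: "j < k" by simp
  \<comment> \<open>The innovation started at \<open>u + j * b\<close> is known at time
    \<open>u + Suc j * b\<close>, just when the next one starts.\<close>
  have "u + j * b + b \<le> u + k * b"
    using mult_le_mono1[of "Suc j" k b] j by simp
  then show "(\<lambda>\<omega>. innovation b (\<Phi> j) (u + j * b) \<omega>) \<in> borel_measurable (past M S X (u + k * b))"
    by (rule measurable_past_mono) (use u in \<open>auto intro!: innovation_measurable \<Phi>[OF j]\<close>)
qed

text \<open>Starting times \<open>b\<close> apart make the innovations a martingale difference
  sequence: when the last one starts, all earlier ones are known and serve as \<open>Y\<close> in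
  \<open>innovation_mgf\<close>.\<close>

lemma innovation_sum_mgf:
  assumes u: "1 \<le> u" and \<Phi>: "\<And>j. j < k \<Longrightarrow> \<Phi> j \<in> borel_measurable (past M S X (u + j * b) \<Otimes>\<^sub>M S)"
    and bound: "\<And>j \<omega> y. j < k \<Longrightarrow> \<omega> \<in> space M \<Longrightarrow> y \<in> space S \<Longrightarrow> \<Phi> j (\<omega>, y) \<in> {lo..lo + w}"
    and l: "0 < l"
  shows "(\<integral>\<^sup>+\<omega>. ennreal (exp (l * (\<Sum>j<k. innovation b (\<Phi> j) (u + j * b) \<omega>))) \<partial>M)
    \<le> ennreal (exp (real k * (l\<^sup>2 * w\<^sup>2 / 8)))"
  using \<Phi> bound
proof (induction k)
  case 0
  then show ?case by (simp add: emeasure_space_1)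
next
  case (Suc k)
  let ?Y = "\<lambda>\<omega>. \<Sum>j<k. innovation b (\<Phi> j) (u + j * b) \<omega>"
  have "(\<integral>\<^sup>+\<omega>. ennreal (exp (l * (?Y \<omega> + innovation b (\<Phi> k) (u + k * b) \<omega>))) \<partial>M)
    \<le> ennreal (exp (l\<^sup>2 * w\<^sup>2 / 8)) * (\<integral>\<^sup>+\<omega>. ennreal (exp (l * ?Y \<omega>)) \<partial>M)"
    by (rule innovation_mgf[where lo=lo])
       (use u l Suc.prems innovation_sum_measurable[of u k \<Phi> b] in auto)
  also have "\<dots> \<le> ennreal (exp (l\<^sup>2 * w\<^sup>2 / 8)) * ennreal (exp (real k * (l\<^sup>2 * w\<^sup>2 / 8)))"
    using Suc.IH Suc.prems by (intro mult_left_mono) auto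
  also have "\<dots> = ennreal (exp (real (Suc k) * (l\<^sup>2 * w\<^sup>2 / 8)))"
    by (simp add: distrib_right add_divide_distrib flip: ennreal_mult exp_add)
  finally show ?case by simp
qed

lemma innovation_sum_upper_tail:
  assumes u: "1 \<le> u" and \<Phi>: "\<And>j. j < k \<Longrightarrow> \<Phi> j \<in> borel_measurable (past M S X (u + j * b) \<Otimes>\<^sub>M S)"
    and bound: "\<And>j \<omega> y. j < k \<Longrightarrow> \<omega> \<in> space M \<Longrightarrow> y \<in> space S \<Longrightarrow> \<Phi> j (\<omega>, y) \<in> {lo..lo + w}"
    and k: "0 < k" and w: "0 < w" and s: "0 < s"
  shows "prob {\<omega> \<in> space M. s \<le> (\<Sum>j<k. innovation b (\<Phi> j) (u + j * b) \<omega>)}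
    \<le> exp (- (2 * s\<^sup>2 / (real k * w\<^sup>2)))"
proof -
  let ?Y = "\<lambda>\<omega>. \<Sum>j<k. innovation b (\<Phi> j) (u + j * b) \<omega>"
  \<comment> \<open>The minimiser of the exponent
    \<open>- l * s + k * l\<^sup>2 * w\<^sup>2 / 8\<close> left by Chernoff's inequality.\<close>
  define l where "l = 4 * s / (real k * w\<^sup>2)"
  have l: "0 < l" using k w s by (simp add: l_def)
  have Y: "?Y \<in> borel_measurable M"
    by (rule measurable_past[OF innovation_sum_measurable[OF u \<Phi>]])
  have "ennreal (prob {\<omega> \<in> space M. s \<le> ?Y \<omega>})
      \<le> ennreal (exp (- l * s)) * (\<integral>\<^sup>+\<omega>. ennreal (exp (l * ?Y \<omega>)) * indicator (space M) \<omega> \<partial>M)"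
    unfolding emeasure_eq_measure[symmetric] using Y
    by (intro Chernoff_ineq_nn_integral_ge l) auto
  also have "\<dots> = ennreal (exp (- l * s)) * (\<integral>\<^sup>+\<omega>. ennreal (exp (l * ?Y \<omega>)) \<partial>M)"
    by (intro arg_cong[where f="\<lambda>x. _ * x"] nn_integral_cong) simp
  also have "\<dots> \<le> ennreal (exp (- l * s)) * ennreal (exp (real k * (l\<^sup>2 * w\<^sup>2 / 8)))"
    by (intro mult_left_mono innovation_sum_mgf[OF u \<Phi> bound l]) auto
  also have "\<dots> = ennreal (exp (- l * s + real k * (l\<^sup>2 * w\<^sup>2 / 8)))"
    by (simp flip: ennreal_mult exp_add)
  also have "- l * s + real k * (l\<^sup>2 * w\<^sup>2 / 8) = - (2 * s\<^sup>2 / (real k * w\<^sup>2))"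
    using k w by (simp add: l_def field_simps power2_eq_square)
  finally show ?thesis by simp
qed

lemma innovation_uminus:
  "innovation b (\<lambda>z. - \<Phi> z) n \<omega> = - innovation b \<Phi> n \<omega>"
  by (simp add: innovation_def kernel_int_def)

lemma innovation_sum_tail:
  assumes u: "1 \<le> u" and \<Phi>: "\<And>j. j < k \<Longrightarrow> \<Phi> j \<in> borel_measurable (past M S X (u + j * b) \<Otimes>\<^sub>M S)"
    and bound: "\<And>j \<omega> y. j < k \<Longrightarrow> \<omega> \<in> space M \<Longrightarrow> y \<in> space S \<Longrightarrow> \<Phi> j (\<omega>, y) \<in> {lo..lo + w}"
    and k: "0 < k" and w: "0 < w" and s: "0 < s"
  shows "prob {\<omega> \<in> space M. s \<le> \<bar>\<Sum>j<k. innovation b (\<Phi> j) (u + j * b) \<omega>\<bar>}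
    \<le> 2 * exp (- (2 * s\<^sup>2 / (real k * w\<^sup>2)))"
proof -
  let ?Y = "\<lambda>\<omega>. \<Sum>j<k. innovation b (\<Phi> j) (u + j * b) \<omega>"
  let ?U = "{\<omega> \<in> space M. s \<le> ?Y \<omega>}" and ?L = "{\<omega> \<in> space M. s \<le> - ?Y \<omega>}"
  have Y[measurable]: "?Y \<in> borel_measurable M"
    by (rule measurable_past[OF innovation_sum_measurable[OF u \<Phi>]])
  have "{\<omega> \<in> space M. s \<le> \<bar>?Y \<omega>\<bar>} = ?U \<union> ?L" by auto
  then have "prob {\<omega> \<in> space M. s \<le> \<bar>?Y \<omega>\<bar>} \<le> prob ?U + prob ?L"
    by (simp add: measure_Un_le)
  moreover have "prob ?U \<le> exp (- (2 * s\<^sup>2 / (real k * w\<^sup>2)))"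
    by (rule innovation_sum_upper_tail[OF u \<Phi> bound k w s])
  moreover have "prob {\<omega> \<in> space M. s \<le> (\<Sum>j<k. innovation b (\<lambda>z. - \<Phi> j z) (u + j * b) \<omega>)}
      \<le> exp (- (2 * s\<^sup>2 / (real k * w\<^sup>2)))"
  proof (rule innovation_sum_upper_tail[OF u _ _ k w s])
    show "(\<lambda>z. - \<Phi> j z) \<in> borel_measurable (past M S X (u + j * b) \<Otimes>\<^sub>M S)" if "j < k" for j
      using \<Phi>[OF that] by measurable
    show "- \<Phi> j (\<omega>, y) \<in> {- (lo + w)..- (lo + w) + w}"
      if "j < k" "\<omega> \<in> space M" "y \<in> space S" for j \<omega> y
      using bound[OF that] by auto
  qed
  ultimately show ?thesis by (simp add: innovation_uminus sum_negf)
qed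

end

section \<open>Concentration of empirical means\<close>

text \<open>A layer-cake argument: \<open>g\<close> is within 1/K of the average of the indicators
  of K level sets, and the \<nu>-measure of each exceeds its \<pi>-measure by at most \<eta>.
  Averaging the K errors gives \<eta> with constant 1.\<close>

lemma integral_le_of_setwise:
  fixes g :: "'a \<Rightarrow> real"
  assumes \<nu>: "\<nu> \<in> space (prob_algebra S)" and \<pi>: "\<pi> \<in> space (prob_algebra S)"
    and g: "g \<in> borel_measurable S" "\<And>x. x \<in> space S \<Longrightarrow> g x \<in> {0..1}"
    and close: "\<And>A. A \<in> sets S \<Longrightarrow> measure \<nu> A \<le> measure \<pi> A + \<eta>"
  shows "(\<integral>x. g x \<partial>\<nu>) \<le> (\<integral>x. g x \<partial>\<pi>) + \<eta>"
proof (rule field_le_epsilon)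
  fix e :: real assume "0 < e"
  then obtain K where K: "0 < K" "inverse (real K) < e"
    using ex_inverse_of_nat_less by blast
  have sets: "sets \<nu> = sets S" "sets \<pi> = sets S" using \<nu> \<pi> by (auto simp: space_prob_algebra)
  have space: "space \<nu> = space S" "space \<pi> = space S" 
    using sets_eq_imp_space_eq[OF sets(1)] sets_eq_imp_space_eq[OF sets(2)] .
  interpret \<nu>: prob_space \<nu> using \<nu> by (simp add: space_prob_algebra)
  interpret \<pi>: prob_space \<pi> using \<pi> by (simp add: space_prob_algebra)
  define A where "A i = {x \<in> space S. real i \<le> real K * g x}" for i
  have A: "A i \<in> sets S" for i unfolding A_def using g(1) by measurable
  \<comment> \<open>As \<open>g\<close> is at most 1, the indices \<open>i \<ge> 1\<close> with
    \<open>x\<close> in \<open>A i\<close> run up to the floor of \<open>real K * g x\<close>; so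
    \<open>gK\<close> rounds \<open>g\<close> down to a multiple of 1/K.\<close>
  define gK where "gK x = (\<Sum>i=1..K. indicator (A i) x / real K)" for x
  have gK: "gK x = real_of_int \<lfloor>real K * g x\<rfloor> / real K" if x: "x \<in> space S" for x
  proof -
    have ge0: "0 \<le> real K * g x" and le: "real K * g x \<le> real K"
      using g(2)[OF x] K(1) by (auto simp: mult_left_le)
    define v where "v = nat \<lfloor>real K * g x\<rfloor>"
    have v: "real i \<le> real K * g x \<longleftrightarrow> i \<le> v" for i
      using ge0 by (simp add: v_def le_nat_iff le_floor_iff)
    have "v \<le> K" using le unfolding v_def by linarith
    have Av: "x \<in> A i \<longleftrightarrow> i \<le> v" for i using x v[of i] by (simp only: A_def mem_Collect_eq simp_thms)
    have "{i \<in> {1..K}. x \<in> A i} = {1..v}"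
    proof (rule set_eqI)
      fix i show "i \<in> {i \<in> {1..K}. x \<in> A i} \<longleftrightarrow> i \<in> {1..v}"
        using Av[of i] \<open>v \<le> K\<close> by (simp only: mem_Collect_eq atLeastAtMost_iff) (blast intro: order_trans)
    qed
    then have "real v = (\<Sum>i\<in>{i \<in> {1..K}. x \<in> A i}. 1)" by simp
    also have "\<dots> = (\<Sum>i=1..K. if x \<in> A i then 1 else 0)" by (rule sum.inter_filter) simp
    also have "\<dots> = (\<Sum>i=1..K. indicator (A i) x)" by (intro sum.cong) auto
    finally have "(\<Sum>i=1..K. indicator (A i) x) = real_of_int \<lfloor>real K * g x\<rfloor>"
      using ge0 by (simp add: v_def)
    then show ?thesis by (simp add: gK_def flip: sum_divide_distrib)
  qed
  have lower: "gK x \<le> g x" and upper: "g x \<le> gK x + inverse (real K)" if "x \<in> space S" for x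
  proof -
    have "real_of_int \<lfloor>real K * g x\<rfloor> / real K \<le> (real K * g x) / real K"
      by (intro divide_right_mono) auto
    then show "gK x \<le> g x" using K(1) gK[OF that] by simp
    have "(real K * g x) / real K \<le> (real_of_int \<lfloor>real K * g x\<rfloor> + 1) / real K"
      by (intro divide_right_mono) linarith+
    then show "g x \<le> gK x + inverse (real K)"
      using K(1) gK[OF that] by (simp add: add_divide_distrib inverse_eq_divide)
  qed
  have int: "integrable \<nu> g" "integrable \<pi> g"
    using g sets space
    by (auto intro!: \<nu>.integrable_const_bound[where B=1] \<pi>.integrable_const_bound[where B=1] AE_I2
        cong: measurable_cong_sets)
  have intA: "integrable \<nu> (\<lambda>x. indicator (A i) x / real K)" "integrable \<pi> (\<lambda>x. indicator (A i) x / real K)" for i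
    using A sets
    by (auto intro!: integrable_divide integrable_real_indicator
        simp: \<nu>.emeasure_eq_measure \<pi>.emeasure_eq_measure)
  have intK: "integrable \<nu> gK" "integrable \<pi> gK"
    unfolding gK_def by (intro Bochner_Integration.integrable_sum intA)+
  have "(\<integral>x. gK x \<partial>\<nu>) = (\<Sum>i=1..K. measure \<nu> (A i) / real K)"
    unfolding gK_def using A sets intA by (subst Bochner_Integration.integral_sum) auto
  also have "\<dots> \<le> (\<Sum>i=1..K. measure \<pi> (A i) / real K + \<eta> / real K)"
    using close[OF A] by (intro sum_mono) (simp add: divide_right_mono flip: add_divide_distrib)
  also have "\<dots> = (\<integral>x. gK x \<partial>\<pi>) + \<eta>"
    unfolding gK_def using A sets K(1) intA
    by (subst Bochner_Integration.integral_sum) (auto simp: sum.distrib)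
  finally have *: "(\<integral>x. gK x \<partial>\<nu>) \<le> (\<integral>x. gK x \<partial>\<pi>) + \<eta>" .
  have "(\<integral>x. g x \<partial>\<nu>) \<le> (\<integral>x. gK x + inverse (real K) \<partial>\<nu>)"
    using upper space by (intro integral_mono int Bochner_Integration.integrable_add intK) auto
  also have "\<dots> = (\<integral>x. gK x \<partial>\<nu>) + inverse (real K)" using intK by (simp add: \<nu>.prob_space)
  also have "\<dots> \<le> (\<integral>x. gK x \<partial>\<pi>) + \<eta> + e" using * K(2) by simp
  also have "(\<integral>x. gK x \<partial>\<pi>) \<le> (\<integral>x. g x \<partial>\<pi>)"
    using lower space by (intro integral_mono int intK) auto
  finally show "(\<integral>x. g x \<partial>\<nu>) \<le> (\<integral>x. g x \<partial>\<pi>) + \<eta> + e" by simp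
qed

lemma integral_diff_le_of_setwise:
  fixes g :: "'a \<Rightarrow> real"
  assumes "\<nu> \<in> space (prob_algebra S)" "\<pi> \<in> space (prob_algebra S)"
    and "g \<in> borel_measurable S" "\<And>x. x \<in> space S \<Longrightarrow> g x \<in> {0..1}"
    and close: "\<And>A. A \<in> sets S \<Longrightarrow> \<bar>measure \<nu> A - measure \<pi> A\<bar> \<le> \<eta>"
  shows "\<bar>(\<integral>x. g x \<partial>\<nu>) - (\<integral>x. g x \<partial>\<pi>)\<bar> \<le> \<eta>"
proof -
  have "measure \<nu> A \<le> measure \<pi> A + \<eta>" "measure \<pi> A \<le> measure \<nu> A + \<eta>" if "A \<in> sets S" for A
    using close[OF that] by linarith+
  then show ?thesis
    using integral_le_of_setwise[OF assms(1-4), of \<eta>] integral_le_of_setwise[OF assms(2,1,3,4), of \<eta>]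
    by (simp add: abs_le_iff)
qed

section \<open>Tail bounds for fixed functions and for the paired risk\<close>

locale ergodic_chain = observed_chain M S P X + doeblin_kernel S P m \<delta> \<mu> \<pi>
  for M :: "'w measure" and S :: "'e measure" and P X m \<delta> \<mu> \<pi>
begin

text \<open>Conditioning on \<open>X n\<close> and using a bound from every state makes the initial
  law irrelevant.\<close>

lemma null_visit:
  assumes n: "1 \<le> n" and N: "N \<in> null_sets \<pi>"
  shows "prob {\<omega> \<in> space M. X (n + j) \<omega> \<in> N} \<le> (1 - \<delta>) ^ (j div m)"
proof -
  have N': "N \<in> sets S" using N \<pi> by (auto simp: space_prob_algebra)
  have d: "0 \<le> (1 - \<delta>) ^ (j div m)" using \<delta>_le_1 by simp
  have "emeasure M {\<omega> \<in> space M. X (n + j) \<omega> \<in> N}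
      = (\<integral>\<^sup>+\<omega>. indicator {\<omega> \<in> space M. X (n + j) \<omega> \<in> N} \<omega> \<partial>M)"
    using N' n by (subst nn_integral_indicator)
      (auto intro!: measurable_sets_Collect[of "X (n + j)" M S] X_measurable)
  also have "\<dots> = (\<integral>\<^sup>+\<omega>. (\<lambda>z. indicator N (snd z)) (\<omega>, X (n + j) \<omega>) \<partial>M)"
    by (intro nn_integral_cong) (auto simp: indicator_def)
  also have "\<dots> = (\<integral>\<^sup>+\<omega>. (\<integral>\<^sup>+y. indicator N y \<partial>kernel_pow S P j (X n \<omega>)) \<partial>M)"
    by (subst lagged_kernel[OF n]) (use N' in auto)
  also have "\<dots> \<le> (\<integral>\<^sup>+\<omega>. ennreal ((1 - \<delta>) ^ (j div m)) \<partial>M)"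
  proof (rule nn_integral_mono)
    fix \<omega> assume "\<omega> \<in> space M"
    then have x: "X n \<omega> \<in> space S" using measurable_space[OF X_measurable[OF n]] by simp
    interpret K: prob_space "kernel_pow S P j (X n \<omega>)" by (rule prob_space_kernel_pow[OF x])
    show "(\<integral>\<^sup>+y. indicator N y \<partial>kernel_pow S P j (X n \<omega>)) \<le> ennreal ((1 - \<delta>) ^ (j div m))"
      using kernel_pow_null_set[OF N x, of j] N' sets_kernel_pow[OF x]
      by (simp add: K.emeasure_eq_measure ennreal_leI)
  qed
  also have "\<dots> = ennreal ((1 - \<delta>) ^ (j div m))" by (simp add: emeasure_space_1)
  finally show ?thesis using d by (simp add: emeasure_eq_measure)
qed

text \<open>The Poisson equation writes the centred sum as a martingale plus boundary terms. In the
  threshold, \<open>2 * B\<close> pays for the two boundary values of the solution and 1 for its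
  truncation; the exponent reflects martingale increments with range of length
  \<open>2 * B\<close>.\<close>

lemma empirical_mean_tail:
  assumes g: "g \<in> borel_measurable S" "\<And>y. y \<in> space S \<Longrightarrow> g y \<in> {0..1}"
    and k: "0 < k" and s: "0 < s"
  defines "B \<equiv> real m / \<delta>"
  shows "prob {\<omega> \<in> space M. s + 2 * B + 1 \<le> \<bar>(\<Sum>i=1..k. g (X i \<omega>)) - real k * (\<integral>y. g y \<partial>\<pi>)\<bar>}
    \<le> 2 * exp (- (s\<^sup>2 / (2 * real k * B\<^sup>2)))"
proof -
  let ?I = "\<integral>y. g y \<partial>\<pi>"
  have B: "0 < B" using m_pos \<delta>_pos by (simp add: B_def)
  \<comment> \<open>Makes the truncation error at most \<open>1 / k\<close> in each of the
    \<open>k\<close> terms.\<close>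
  obtain q where q: "(1 - \<delta>) ^ q < 1 / real k"
    using real_arch_pow_inv[of "1 / real k" "1 - \<delta>"] k \<delta>_pos by auto
  define J where "J = m * q"
  have J: "(1 - \<delta>) ^ (J div m) \<le> 1 / real k" using q m_pos by (simp add: J_def)
  let ?G = "poisson J g"
  let ?\<Phi> = "\<lambda>j::nat. \<lambda>z::'w \<times> 'e. ?G (snd z)"
  let ?Y = "\<lambda>\<omega>. \<Sum>j<k. innovation 1 (?\<Phi> j) (1 + j * 1) \<omega>"
  have \<Phi>: "?\<Phi> j \<in> borel_measurable (past M S X (1 + j * 1) \<Otimes>\<^sub>M S)" for j
    by (rule measurable_compose[OF measurable_snd poisson_measurable[OF g(1)]])
  have bound: "?\<Phi> j (\<omega>, y) \<in> {- B..- B + 2 * B}" if "y \<in> space S" for j \<omega> y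
    using poisson_bound[OF g that, of J] by (simp add: B_def abs_le_iff)
  have tail: "prob {\<omega> \<in> space M. s \<le> \<bar>?Y \<omega>\<bar>} \<le> 2 * exp (- (2 * s\<^sup>2 / (real k * (2 * B)\<^sup>2)))"
    using B by (intro innovation_sum_tail[OF _ \<Phi> bound k _ s]) auto
  have eq: "2 * s\<^sup>2 / (real k * (2 * B)\<^sup>2) = s\<^sup>2 / (2 * real k * B\<^sup>2)"
    by (simp add: power_mult_distrib)
  have meas: "{\<omega> \<in> space M. s \<le> \<bar>?Y \<omega>\<bar>} \<in> sets M"
    using measurable_past[OF innovation_sum_measurable[of 1 k ?\<Phi> 1]] \<Phi> by measurable
  have sub: "{\<omega> \<in> space M. s + 2 * B + 1 \<le> \<bar>(\<Sum>i=1..k. g (X i \<omega>)) - real k * ?I\<bar>}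
      \<subseteq> {\<omega> \<in> space M. s \<le> \<bar>?Y \<omega>\<bar>}"
  proof safe
    fix \<omega> assume \<omega>: "\<omega> \<in> space M" and le: "s + 2 * B + 1 \<le> \<bar>(\<Sum>i=1..k. g (X i \<omega>)) - real k * ?I\<bar>"
    have x: "X i \<omega> \<in> space S" if "1 \<le> i" for i
      using measurable_space[OF X_measurable[OF that] \<omega>] .
    let ?e = "\<lambda>i. kernel_int J g (X i \<omega>) - ?I"
    have "(\<Sum>i=1..k. g (X i \<omega>)) - real k * ?I = (\<Sum>i=1..k. g (X i \<omega>) - ?I)"
      by (simp add: sum_subtractf)
    also have "\<dots> = (\<Sum>i=1..k. ?G (X i \<omega>) - kernel_int 1 ?G (X i \<omega>) + ?e i)"
      using poisson_equation[OF g x] by (intro sum.cong) auto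
    also have "\<dots> = (\<Sum>j<k. ?G (X (Suc j) \<omega>) - kernel_int 1 ?G (X (Suc j) \<omega>)) + (\<Sum>i=1..k. ?e i)"
      by (simp add: sum.distrib sum.atLeast1_atMost_eq)
    \<comment> \<open>An innovation compares the prediction from the current state with the value at
      the next state, not at the current one; the correction telescopes to the two boundary
      values.\<close>
    also have "(\<Sum>j<k. ?G (X (Suc j) \<omega>) - kernel_int 1 ?G (X (Suc j) \<omega>))
        = (\<Sum>j<k. innovation 1 (?\<Phi> j) (1 + j * 1) \<omega> + (?G (X (Suc j) \<omega>) - ?G (X (Suc (Suc j)) \<omega>)))"
      by (intro sum.cong) (auto simp: innovation_def)
    also have "\<dots> = ?Y \<omega> + (?G (X 1 \<omega>) - ?G (X (Suc k) \<omega>))"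
      using sum_lessThan_telescope'[of "\<lambda>j. ?G (X (Suc j) \<omega>)" k] by (simp add: sum.distrib)
    finally have eq: "(\<Sum>i=1..k. g (X i \<omega>)) - real k * ?I
      = ?Y \<omega> + (?G (X 1 \<omega>) - ?G (X (Suc k) \<omega>)) + (\<Sum>i=1..k. ?e i)" .
    have "\<bar>?e i\<bar> \<le> 1 / real k" if "1 \<le> i" for i
      using kernel_int_stationary_dist[OF g x[OF that], of J] J by linarith
    then have "\<bar>\<Sum>i=1..k. ?e i\<bar> \<le> (\<Sum>i=1..k. 1 / real k)"
      by (intro order_trans[OF sum_abs] sum_mono) auto
    then have "\<bar>\<Sum>i=1..k. ?e i\<bar> \<le> 1" using k by simp
    moreover have "\<bar>?G (X 1 \<omega>)\<bar> \<le> B" "\<bar>?G (X (Suc k) \<omega>)\<bar> \<le> B"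
      using poisson_bound[OF g x, of _ J] by (auto simp: B_def)
    ultimately show "s \<le> \<bar>?Y \<omega>\<bar>" using le unfolding eq by linarith
  qed
  show ?thesis
    using finite_measure_mono[OF sub meas] tail unfolding eq by linarith
qed

text \<open>The budget at each time: \<epsilon> / 8 for replacing the hypothesis by a net element in
  the risk, \<epsilon> / 4 for the concentration of the empirical mean of that element (half of it
  absorbing \<open>2 * B + 1\<close> through \<open>large\<close>), \<epsilon> / 8 for returning to
  the hypothesis, and \<epsilon> / 8 for the lag. The averaged innovations take another \<epsilon> /
  4, and the last \<epsilon> / 8 makes the final inequality strict. The three summands bound the bad
  events \<open>A1\<close>, \<open>A2\<close>, \<open>A3\<close>.\<close>

lemma paired_risk_tail:
  fixes l :: "('e \<times> 'e \<Rightarrow> real) \<Rightarrow> 'e \<Rightarrow> 'e \<Rightarrow> real" and h :: "nat \<Rightarrow> 'w \<Rightarrow> 'e \<times> 'e \<Rightarrow> real"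
  assumes l01: "\<And>g x y. l g x y \<in> {0..1}"
    and lm: "\<And>g. g \<in> H \<Longrightarrow> (\<lambda>(x, x'). l g x x') \<in> borel_measurable (S \<Otimes>\<^sub>M S)"
    and hH: "\<And>t \<omega>. t \<le> n \<Longrightarrow> \<omega> \<in> space M \<Longrightarrow> h t \<omega> \<in> H"
    and hm: "\<And>t. t \<le> n \<Longrightarrow>
      (\<lambda>(\<omega>, x, x'). l (h t \<omega>) x x') \<in> borel_measurable (past M S X t \<Otimes>\<^sub>M (S \<Otimes>\<^sub>M S))"
    and G: "finite G" "G \<subseteq> H"
    and cover: "\<And>h. h \<in> H \<Longrightarrow>
      \<exists>g\<in>G. \<forall>x\<in>space S. \<forall>y\<in>space S. \<bar>l g x y - l h x y\<bar> \<le> \<epsilon> / 8"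
    and N: "N \<in> null_sets \<pi>"
    and rate: "\<And>x A. x \<in> space S \<Longrightarrow> x \<notin> N \<Longrightarrow> A \<in> sets S \<Longrightarrow>
      \<bar>measure (kernel_pow S P b x) A - measure \<pi> A\<bar> \<le> \<epsilon> / 8"
    and b: "1 \<le> b" "b < a" and n: "a < n" "b \<le> n - a" and \<epsilon>: "0 < \<epsilon>"
    and large: "2 * (real m / \<delta>) + 1 \<le> (real a - real b) * \<epsilon> / 8"
  shows "prob {\<omega> \<in> space M.
      \<bar>1 / (real n - real a) * (\<Sum>t=a..<n. risk \<pi> l (h (t - b) \<omega>)) - avg_paired_risk l X h b a n \<omega>\<bar> \<ge> \<epsilon>}
    \<le> real (n - a) * (real (card G) * (2 * exp (- (\<epsilon>\<^sup>2 * real (a - b) / (128 * (real m / \<delta>)\<^sup>2)))))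
      + real (n - a) * (1 - \<delta>) ^ ((a - b - 1) div m)
      + real b * (2 * exp (- (\<epsilon>\<^sup>2 * real (n - a) / (16 * real b))))"
proof -
  define B where "B = real m / \<delta>"
  have B: "0 < B" using m_pos \<delta>_pos by (simp add: B_def)
  interpret \<pi>: prob_space \<pi> using \<pi> by (simp add: space_prob_algebra)
  have sets\<pi> [measurable_cong]: "sets \<pi> = sets S" using \<pi> by (simp add: space_prob_algebra)
  have space\<pi>: "space \<pi> = space S" using sets_eq_imp_space_eq[OF sets\<pi>] .
  have Xs: "X i \<omega> \<in> space S" if "1 \<le> i" "\<omega> \<in> space M" for i \<omega>
    using measurable_space[OF X_measurable[OF that(1)] that(2)] .

  \<comment> \<open>In \<open>paired_risk\<close> the new state is the first argument of the loss
    and the past state the second; hence the average over the first argument.\<close>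
  define mean where "mean g x = (\<integral>y. l g y x \<partial>\<pi>)" for g x
  have sec: "(\<lambda>y. l g y x) \<in> borel_measurable S" if "g \<in> H" "x \<in> space S" for g x
    using measurable_compose[OF measurable_Pair2'[OF that(2)] lm[OF that(1)]] by simp
  have int_sec: "integrable \<pi> (\<lambda>y. l g y x)" if "g \<in> H" "x \<in> space S" for g x
    by (rule integrable_bounded_prob(1)[OF \<pi> sec[OF that] l01])
  have mean_m: "mean g \<in> borel_measurable S" if "g \<in> H" for g
  proof -
    have "(\<lambda>(x, y). l g y x) \<in> borel_measurable (S \<Otimes>\<^sub>M S)"
      using measurable_compose[OF measurable_pair_swap' lm[OF that]] by (simp add: split_beta')
    then have "(\<lambda>(x, y). l g y x) \<in> borel_measurable (S \<Otimes>\<^sub>M \<pi>)"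
      by (simp cong: measurable_cong_sets)
    then show ?thesis unfolding mean_def by (rule \<pi>.borel_measurable_lebesgue_integral)
  qed
  have mean01: "mean g x \<in> {0..1}" if "g \<in> H" "x \<in> space S" for g x
    unfolding mean_def by (rule integrable_bounded_prob(2)[OF \<pi> sec[OF that] l01])
  have int_mean: "integrable \<pi> (mean g)" if "g \<in> H" for g
    by (rule integrable_bounded_prob(1)[OF \<pi> mean_m[OF that] mean01[OF that]])
  have risk: "risk \<pi> l g = (\<integral>x. mean g x \<partial>\<pi>)" if "g \<in> H" for g
  proof -
    interpret \<pi>\<pi>: pair_prob_space \<pi> \<pi> ..
    have "integrable (\<pi> \<Otimes>\<^sub>M \<pi>) (\<lambda>(x, x'). l g x x')"
      using lm[OF that] l01
      by (intro \<pi>\<pi>.integrable_const_bound[where B=1]) (auto intro!: AE_I2 cong: measurable_cong_sets)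
    from \<pi>\<pi>.integral_snd[OF this] show ?thesis
      by (simp add: risk_def mean_def)
  qed
  have mean_close: "\<bar>mean g x - mean g' x\<bar> \<le> \<epsilon> / 8"
    if "g \<in> H" "g' \<in> H" "x \<in> space S" "\<forall>x\<in>space S. \<forall>y\<in>space S. \<bar>l g x y - l g' x y\<bar> \<le> \<epsilon> / 8" for g g' x
  proof -
    have "mean g x - mean g' x = (\<integral>y. l g y x - l g' y x \<partial>\<pi>)"
      unfolding mean_def using int_sec that by simp
    moreover have "\<dots> \<in> {- (\<epsilon> / 8)..\<epsilon> / 8}"
    proof (rule integrable_bounded_prob(2)[OF \<pi>])
      show "l g y x - l g' y x \<in> {- (\<epsilon> / 8)..\<epsilon> / 8}" if "y \<in> space S" for y
        using bspec[OF bspec[OF \<open>\<forall>x\<in>space S. _ x\<close> that] \<open>x \<in> space S\<close>] unfolding abs_le_iff by auto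
    qed (use sec that in auto)
    ultimately show ?thesis by auto
  qed
  have risk_close: "\<bar>risk \<pi> l g - risk \<pi> l g'\<bar> \<le> \<epsilon> / 8"
    if "g \<in> H" "g' \<in> H" "\<forall>x\<in>space S. \<forall>y\<in>space S. \<bar>l g x y - l g' x y\<bar> \<le> \<epsilon> / 8" for g g'
  proof -
    have "risk \<pi> l g - risk \<pi> l g' = (\<integral>x. mean g x - mean g' x \<partial>\<pi>)"
      using int_mean that by (simp add: risk)
    moreover have "\<dots> \<in> {- (\<epsilon> / 8)..\<epsilon> / 8}"
    proof (rule integrable_bounded_prob(2)[OF \<pi>])
      show "mean g x - mean g' x \<in> {- (\<epsilon> / 8)..\<epsilon> / 8}" if "x \<in> space S" for x
        using mean_close[OF \<open>g \<in> H\<close> \<open>g' \<in> H\<close> that \<open>\<forall>x\<in>space S. _ x\<close>] unfolding abs_le_iff by auto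
    qed (use mean_m that in auto)
    ultimately show ?thesis by auto
  qed

  \<comment> \<open>Concentration is asked of deterministic net elements only; the union over
    \<open>G\<close> then serves whichever of them is near the random hypothesis.\<close>
  define E1 where "E1 t g = {\<omega> \<in> space M. real (t - b) * \<epsilon> / 8 + 2 * B + 1
      \<le> \<bar>(\<Sum>i=1..t-b. mean g (X i \<omega>)) - real (t - b) * (\<integral>x. mean g x \<partial>\<pi>)\<bar>}" for t g
  define E2 where "E2 t = {\<omega> \<in> space M. X (t - b) \<omega> \<in> N}" for t

  \<comment> \<open>The paired risk with \<open>X t\<close> freed as second variable; all the rest
    is known at time \<open>t - b\<close>. The value 0 from time \<open>n\<close> on pads the
    residue classes to a common length.\<close>
  define \<Phi> where "\<Phi> t z = (if t < n then
      1 / real (t - b) * (\<Sum>i=1..t-b. l (h (t - b) (fst z)) (snd z) (X i (fst z))) else 0)" for t z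
  have \<Phi>m: "\<Phi> t \<in> borel_measurable (past M S X (t - b) \<Otimes>\<^sub>M S)" for t
  proof (cases "t < n")
    case True
    have "(\<lambda>z. l (h (t - b) (fst z)) (snd z) (X i (fst z))) \<in> borel_measurable (past M S X (t - b) \<Otimes>\<^sub>M S)"
      if "i \<in> {1..t-b}" for i
    proof -
      have "(\<lambda>z. (fst z, snd z, X i (fst z))) \<in> past M S X (t - b) \<Otimes>\<^sub>M S \<rightarrow>\<^sub>M past M S X (t - b) \<Otimes>\<^sub>M (S \<Otimes>\<^sub>M S)"
        using that by (intro measurable_Pair measurable_fst measurable_snd
            measurable_compose[OF measurable_fst] X_past_measurable) auto
      from measurable_compose[OF this hm] True show ?thesis by simp
    qed
    then show ?thesis
      using True unfolding \<Phi>_def by (simp add: borel_measurable_sum borel_measurable_divide)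
  next
    case False
    then show ?thesis by (simp add: \<Phi>_def[abs_def])
  qed
  have \<Phi>01: "\<Phi> t z \<in> {0..0 + 1}" for t z
  proof (cases "t < n \<and> b < t")
    case True
    have "0 \<le> (\<Sum>i=1..t-b. l (h (t - b) (fst z)) (snd z) (X i (fst z)))"
      using l01 by (intro sum_nonneg) auto
    moreover have "(\<Sum>i=1..t-b. l (h (t - b) (fst z)) (snd z) (X i (fst z))) \<le> (\<Sum>i=1..t-b. 1)"
      using l01 by (intro sum_mono) auto
    ultimately show ?thesis using True by (simp add: \<Phi>_def divide_simps)
  qed (auto simp: \<Phi>_def)
  define D where "D t = innovation b (\<Phi> t) (t - b)" for t
  have D0: "D t \<omega> = 0" if "n \<le> t" for t \<omega>
    using that by (simp add: D_def innovation_def \<Phi>_def kernel_int_def)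

  \<comment> \<open>Rounded up so that \<open>k\<close> blocks of length \<open>b\<close> cover the
    times from \<open>a\<close> to \<open>n\<close>; the factor 2 in \<open>k_le\<close> pays for
    the rounding, as \<open>b\<close> is at most \<open>n - a\<close>.\<close>
  define k where "k = (n - a) div b + 1"
  have k_ge: "n \<le> a + k * b"
  proof -
    have "n - a = (n - a) div b * b + (n - a) mod b" by simp
    also have "\<dots> \<le> (n - a) div b * b + b" using b by (intro add_left_mono) (simp add: less_imp_le)
    finally show ?thesis by (simp add: k_def)
  qed
  have k_le: "real k \<le> 2 * real (n - a) / real b"
  proof -
    have "real ((n - a) div b) \<le> real (n - a) / real b" by (rule of_nat_div_le_of_nat)
    moreover have "1 \<le> real (n - a) / real b" using n b by (simp add: divide_simps)
    ultimately show ?thesis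
      unfolding k_def of_nat_add of_nat_1 times_divide_eq_right[symmetric] by linarith
  qed
  \<comment> \<open>The times are sorted by residue class modulo \<open>b\<close>; within a class
    they are \<open>b\<close> apart, as \<open>innovation_sum_tail\<close> requires.\<close>
  have sum_D: "(\<Sum>t=a..<n. D t \<omega>) = (\<Sum>r<b. \<Sum>j<k. D (a + r + j * b) \<omega>)" for \<omega>
  proof -
    have "(\<Sum>t=a..<n. D t \<omega>) = (\<Sum>t=a..<a + k * b. D t \<omega>)"
      using k_ge by (intro sum.mono_neutral_left) (auto simp: D0)
    also have "\<dots> = (\<Sum>i<k * b. D (a + i) \<omega>)"
      using sum.shift_bounds_nat_ivl[of "\<lambda>t. D t \<omega>" 0 a "k * b"] by (simp add: lessThan_atLeast0 add.commute)
    also have "\<dots> = (\<Sum>j<k. \<Sum>i=j*b..<j*b+b. D (a + i) \<omega>)" by (rule sum.nat_group[symmetric])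
    also have "\<dots> = (\<Sum>j<k. \<Sum>r<b. D (a + r + j * b) \<omega>)"
    proof (rule sum.cong[OF refl])
      fix j
      show "(\<Sum>i=j*b..<j*b+b. D (a + i) \<omega>) = (\<Sum>r<b. D (a + r + j * b) \<omega>)"
        using sum.shift_bounds_nat_ivl[of "\<lambda>i. D (a + i) \<omega>" 0 "j * b" b]
        by (simp add: lessThan_atLeast0 algebra_simps)
    qed
    also have "\<dots> = (\<Sum>r<b. \<Sum>j<k. D (a + r + j * b) \<omega>)" by (rule sum.swap)
    finally show ?thesis .
  qed
  \<comment> \<open>Chosen so that all \<open>b\<close> classes together contribute at most
    \<open>(n - a) * \<epsilon> / 4\<close>.\<close>
  define s where "s = real (n - a) * \<epsilon> / (4 * real b)"
  have s: "0 < s" using n b \<epsilon> by (simp add: s_def)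
  define E3 where "E3 r = {\<omega> \<in> space M. s \<le> \<bar>\<Sum>j<k. D (a + r + j * b) \<omega>\<bar>}" for r

  \<comment> \<open>Since \<open>b < a\<close>, truncated subtraction commutes with adding
    \<open>j * b\<close>, and the common starting time \<open>a + r - b\<close> is at least
    1.\<close>
  have \<Phi>_lag: "\<Phi> (a + r + j * b) \<in> borel_measurable (past M S X ((a + r - b) + j * b) \<Otimes>\<^sub>M S)" for r j
    using \<Phi>m[of "a + r + j * b"] b by (simp add: algebra_simps)
  have D_lag: "D (a + r + j * b) = innovation b (\<Phi> (a + r + j * b)) ((a + r - b) + j * b)" for r j
    unfolding D_def using b by (simp add: algebra_simps)

  have E1_sets: "E1 t g \<in> sets M" if "g \<in> H" for t g
  proof -
    have "(\<lambda>\<omega>. \<Sum>i=1..t-b. mean g (X i \<omega>)) \<in> borel_measurable M"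
      by (rule borel_measurable_sum)
         (rule measurable_compose[OF X_measurable mean_m[OF that]], simp)
    then show ?thesis unfolding E1_def by measurable
  qed
  have E2_sets: "E2 t \<in> sets M" if "t \<in> {a..<n}" for t
  proof -
    have "E2 t = X (t - b) -` N \<inter> space M" by (auto simp: E2_def)
    moreover have "N \<in> sets S" using N sets\<pi> by (metis null_setsD2)
    moreover have "1 \<le> t - b" using b that by auto
    ultimately show ?thesis using measurable_sets[OF X_measurable] by metis
  qed
  have E3_sets: "E3 r \<in> sets M" for r
  proof -
    have "(\<lambda>\<omega>. \<Sum>j<k. D (a + r + j * b) \<omega>) \<in> borel_measurable M"
      unfolding D_lag by (rule measurable_past[OF innovation_sum_measurable[OF _ \<Phi>_lag]]) (use b in simp)
    then show ?thesis unfolding E3_def by measurable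
  qed

  have E1_prob: "prob (E1 t g) \<le> 2 * exp (- (\<epsilon>\<^sup>2 * real (a - b) / (128 * B\<^sup>2)))"
    if "t \<in> {a..<n}" "g \<in> H" for t g
  proof -
    have t: "0 < t - b" using that b by auto
    have "prob (E1 t g) \<le> 2 * exp (- ((real (t - b) * \<epsilon> / 8)\<^sup>2 / (2 * real (t - b) * B\<^sup>2)))"
      unfolding E1_def B_def using t \<epsilon>
      by (intro empirical_mean_tail mean_m mean01 that) auto
    also have "(real (t - b) * \<epsilon> / 8)\<^sup>2 / (2 * real (t - b) * B\<^sup>2) = \<epsilon>\<^sup>2 * real (t - b) / (128 * B\<^sup>2)"
      using t B by (simp add: field_simps power2_eq_square)
    also have "2 * exp (- (\<epsilon>\<^sup>2 * real (t - b) / (128 * B\<^sup>2))) \<le> 2 * exp (- (\<epsilon>\<^sup>2 * real (a - b) / (128 * B\<^sup>2)))"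
    proof -
      have "\<epsilon>\<^sup>2 * real (a - b) / (128 * B\<^sup>2) \<le> \<epsilon>\<^sup>2 * real (t - b) / (128 * B\<^sup>2)"
        using that by (intro divide_right_mono mult_left_mono) auto
      then show ?thesis by simp
    qed
    finally show ?thesis .
  qed
  have E2_prob: "prob (E2 t) \<le> (1 - \<delta>) ^ ((a - b - 1) div m)" if "t \<in> {a..<n}" for t
  proof -
    \<comment> \<open>The chain starts at index 1, so only \<open>t - b - 1\<close> steps have been
      made by time \<open>t - b\<close>.\<close>
    have "t - b = 1 + (t - b - 1)" using that b by auto
    then have "prob (E2 t) \<le> (1 - \<delta>) ^ ((t - b - 1) div m)"
      unfolding E2_def using null_visit[OF le_refl N, of "t - b - 1"] by simp
    also have "\<dots> \<le> (1 - \<delta>) ^ ((a - b - 1) div m)"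
      using that \<delta>_le_1 \<delta>_pos by (intro power_decreasing div_le_mono) auto
    finally show ?thesis .
  qed
  have E3_prob: "prob (E3 r) \<le> 2 * exp (- (\<epsilon>\<^sup>2 * real (n - a) / (16 * real b)))" for r
  proof -
    have k0: "0 < k" by (simp add: k_def)
    have "prob (E3 r) \<le> 2 * exp (- (2 * s\<^sup>2 / (real k * 1\<^sup>2)))"
      unfolding E3_def D_lag
      by (rule innovation_sum_tail[OF _ \<Phi>_lag \<Phi>01]) (use b s k0 in auto)
    also have "\<dots> \<le> 2 * exp (- (\<epsilon>\<^sup>2 * real (n - a) / (16 * real b)))"
    proof -
      have "\<epsilon>\<^sup>2 * real (n - a) / (16 * real b) = 2 * s\<^sup>2 / (2 * real (n - a) / real b)"
        using n b by (simp add: s_def field_simps power2_eq_square)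
      also have "\<dots> \<le> 2 * s\<^sup>2 / real k"
        using k_le k0 n b by (intro divide_left_mono) auto
      finally show ?thesis by simp
    qed
    finally show ?thesis .
  qed

  define A1 where "A1 = (\<Union>t\<in>{a..<n}. \<Union>g\<in>G. E1 t g)"
  define A2 where "A2 = (\<Union>t\<in>{a..<n}. E2 t)"
  define A3 where "A3 = (\<Union>r\<in>{..<b}. E3 r)"
  have GH: "g \<in> H" if "g \<in> G" for g using G that by blast
  have E1G_sets: "(\<Union>g\<in>G. E1 t g) \<in> sets M" for t
    by (intro sets.finite_UN G E1_sets GH)
  have A_sets: "A1 \<in> sets M" "A2 \<in> sets M" "A3 \<in> sets M"
    unfolding A1_def A2_def A3_def
    by (intro sets.finite_UN E1G_sets E2_sets E3_sets finite_atLeastLessThan finite_lessThan; assumption)+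
  have A1_prob: "prob A1 \<le> real (n - a) * (real (card G) * (2 * exp (- (\<epsilon>\<^sup>2 * real (a - b) / (128 * B\<^sup>2)))))"
  proof -
    have "prob A1 \<le> (\<Sum>t\<in>{a..<n}. prob (\<Union>g\<in>G. E1 t g))"
      unfolding A1_def by (intro measure_UNION_le E1G_sets finite_atLeastLessThan)
    also have "\<dots> \<le> (\<Sum>t\<in>{a..<n}. \<Sum>g\<in>G. prob (E1 t g))"
      by (intro sum_mono measure_UNION_le G E1_sets GH)
    also have "\<dots> \<le> (\<Sum>t\<in>{a..<n}. \<Sum>g\<in>G. 2 * exp (- (\<epsilon>\<^sup>2 * real (a - b) / (128 * B\<^sup>2))))"
      by (intro sum_mono E1_prob GH)
    finally show ?thesis by simp
  qed
  have A2_prob: "prob A2 \<le> real (n - a) * (1 - \<delta>) ^ ((a - b - 1) div m)"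
  proof -
    have "prob A2 \<le> (\<Sum>t\<in>{a..<n}. prob (E2 t))"
      unfolding A2_def by (intro measure_UNION_le E2_sets finite_atLeastLessThan)
    also have "\<dots> \<le> (\<Sum>t\<in>{a..<n}. (1 - \<delta>) ^ ((a - b - 1) div m))"
      using E2_prob by (intro sum_mono) auto
    finally show ?thesis by simp
  qed
  have A3_prob: "prob A3 \<le> real b * (2 * exp (- (\<epsilon>\<^sup>2 * real (n - a) / (16 * real b))))"
  proof -
    have "prob A3 \<le> (\<Sum>r\<in>{..<b}. prob (E3 r))"
      unfolding A3_def by (intro measure_UNION_le E3_sets finite_lessThan)
    also have "\<dots> \<le> (\<Sum>r\<in>{..<b}. 2 * exp (- (\<epsilon>\<^sup>2 * real (n - a) / (16 * real b))))"
      using E3_prob by (intro sum_mono) auto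
    finally show ?thesis by simp
  qed

  have sub: "{\<omega> \<in> space M.
      \<bar>1 / (real n - real a) * (\<Sum>t=a..<n. risk \<pi> l (h (t - b) \<omega>)) - avg_paired_risk l X h b a n \<omega>\<bar> \<ge> \<epsilon>}
    \<subseteq> A1 \<union> A2 \<union> A3"
  proof (rule subsetI, rule ccontr)
    fix \<omega>
    assume "\<omega> \<in> {\<omega> \<in> space M.
      \<bar>1 / (real n - real a) * (\<Sum>t=a..<n. risk \<pi> l (h (t - b) \<omega>)) - avg_paired_risk l X h b a n \<omega>\<bar> \<ge> \<epsilon>}"
    then have \<omega>: "\<omega> \<in> space M" and ge: "\<epsilon> \<le> \<bar>1 / (real n - real a) * (\<Sum>t=a..<n. risk \<pi> l (h (t - b) \<omega>))
        - avg_paired_risk l X h b a n \<omega>\<bar>" by auto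
    assume "\<omega> \<notin> A1 \<union> A2 \<union> A3"
    then have nE1: "\<And>t g. t \<in> {a..<n} \<Longrightarrow> g \<in> G \<Longrightarrow> \<omega> \<notin> E1 t g"
      and nE2: "\<And>t. t \<in> {a..<n} \<Longrightarrow> \<omega> \<notin> E2 t"
      and nE3: "\<And>r. r < b \<Longrightarrow> \<omega> \<notin> E3 r"
      by (auto simp: A1_def A2_def A3_def)
    \<comment> \<open>\<open>paired_risk\<close> minus \<open>D t\<close> is the prediction from
      time \<open>t - b\<close>. The path from the risk of the hypothesis to it passes through the
      risk of \<open>g\<close>, the empirical mean of \<open>g\<close> and that of the
      hypothesis.\<close>
    have one: "\<bar>risk \<pi> l (h (t - b) \<omega>) - paired_risk l X h b t \<omega> + D t \<omega>\<bar> \<le> 5 / 8 * \<epsilon>" if t: "t \<in> {a..<n}" for t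
    proof -
      let ?k = "t - b" and ?h = "h (t - b) \<omega>"
      have k: "0 < ?k" "t = ?k + b" using t b by auto
      have hH': "?h \<in> H" using hH[OF _ \<omega>] t by auto
      obtain g where g: "g \<in> G" "\<forall>x\<in>space S. \<forall>y\<in>space S. \<bar>l g x y - l ?h x y\<bar> \<le> \<epsilon> / 8"
        using cover[OF hH'] by blast
      have gH: "g \<in> H" using g G by auto
      define emp where "emp f = 1 / real ?k * (\<Sum>i=1..?k. mean f (X i \<omega>))" for f
      have Xk: "X ?k \<omega> \<in> space S" "X ?k \<omega> \<notin> N"
        using Xs[OF _ \<omega>, of ?k] k nE2[OF t] \<omega> by (auto simp: E2_def)

      have 1: "\<bar>risk \<pi> l g - risk \<pi> l ?h\<bar> \<le> \<epsilon> / 8" by (rule risk_close[OF gH hH' g(2)])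

      have "\<bar>(\<Sum>i=1..?k. mean g (X i \<omega>)) - real ?k * risk \<pi> l g\<bar> < real ?k * \<epsilon> / 8 + 2 * B + 1"
        using nE1[OF t g(1)] \<omega> by (simp add: E1_def risk[OF gH])
      also have "\<dots> \<le> real ?k * \<epsilon> / 8 + (real a - real b) * \<epsilon> / 8" using large by (simp add: B_def)
      also have "\<dots> \<le> real ?k * \<epsilon> / 8 + real ?k * \<epsilon> / 8"
        using t b \<epsilon> by (intro add_left_mono divide_right_mono mult_right_mono) auto
      finally have "\<bar>(\<Sum>i=1..?k. mean g (X i \<omega>)) - real ?k * risk \<pi> l g\<bar> \<le> real ?k * (\<epsilon> / 4)" by (simp add: mult.commute)
      moreover have "(\<Sum>i=1..?k. mean g (X i \<omega>)) - real ?k * risk \<pi> l g = real ?k * (emp g - risk \<pi> l g)"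
        using k by (simp add: emp_def right_diff_distrib)
      ultimately have 2: "\<bar>emp g - risk \<pi> l g\<bar> \<le> \<epsilon> / 4"
        using k by (simp add: abs_mult)

      have "\<bar>(\<Sum>i=1..?k. mean g (X i \<omega>) - mean ?h (X i \<omega>))\<bar> \<le> (\<Sum>i=1..?k. \<epsilon> / 8)"
        using mean_close[OF gH hH' _ g(2)] Xs[OF _ \<omega>] by (intro order_trans[OF sum_abs] sum_mono) auto
      also have "\<dots> = real ?k * (\<epsilon> / 8)" by simp
      also have "(\<Sum>i=1..?k. mean g (X i \<omega>) - mean ?h (X i \<omega>)) = real ?k * (emp g - emp ?h)"
        using k by (simp add: emp_def sum_subtractf right_diff_distrib)
      finally have 3: "\<bar>emp g - emp ?h\<bar> \<le> \<epsilon> / 8"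
        using k by (simp add: abs_mult)

      have \<Phi>s: "(\<lambda>y. \<Phi> t (\<omega>, y)) \<in> borel_measurable S"
        using \<omega> by (intro measurable_compose[OF _ \<Phi>m[of t]]) auto
      \<comment> \<open>A new state drawn from \<pi> turns each loss into \<open>mean ?h\<close>;
        the true b-step law from \<open>X ?k \<omega>\<close>, a state outside \<open>N\<close>, is
        close to \<pi>.\<close>
      have "(\<integral>y. \<Phi> t (\<omega>, y) \<partial>\<pi>) = emp ?h"
        unfolding emp_def mean_def \<Phi>_def using t int_sec[OF hH' Xs[OF _ \<omega>]]
        by (simp add: Bochner_Integration.integral_sum)
      moreover have "\<bar>kernel_int b (\<lambda>y. \<Phi> t (\<omega>, y)) (X ?k \<omega>) - (\<integral>y. \<Phi> t (\<omega>, y) \<partial>\<pi>)\<bar> \<le> \<epsilon> / 8"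
        unfolding kernel_int_def
        by (rule integral_diff_le_of_setwise[OF kernel_pow_in_prob_algebra[OF Xk(1)] \<pi> \<Phi>s _ rate[OF Xk]])
           (use \<Phi>01 in auto)
      moreover have "D t \<omega> = paired_risk l X h b t \<omega> - kernel_int b (\<lambda>y. \<Phi> t (\<omega>, y)) (X ?k \<omega>)"
        using k t by (simp add: D_def innovation_def paired_risk_def \<Phi>_def)
      ultimately have 4: "\<bar>emp ?h - (paired_risk l X h b t \<omega> - D t \<omega>)\<bar> \<le> \<epsilon> / 8" by linarith
      show ?thesis using 1 2 3 4 by linarith
    qed
    have "\<bar>\<Sum>t=a..<n. D t \<omega>\<bar> \<le> (\<Sum>r<b. \<bar>\<Sum>j<k. D (a + r + j * b) \<omega>\<bar>)"
      unfolding sum_D by (rule sum_abs)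
    also have "\<dots> \<le> (\<Sum>r<b. s)"
      using nE3 \<omega> by (intro sum_mono) (auto simp: E3_def not_le less_imp_le)
    also have "\<dots> = real (n - a) * (\<epsilon> / 4)" using b by (simp add: s_def)
    finally have D_sum: "\<bar>\<Sum>t=a..<n. D t \<omega>\<bar> \<le> real (n - a) * (\<epsilon> / 4)" .
    have "\<bar>\<Sum>t=a..<n. risk \<pi> l (h (t - b) \<omega>) - paired_risk l X h b t \<omega> + D t \<omega>\<bar> \<le> (\<Sum>t=a..<n. 5 / 8 * \<epsilon>)"
      using one by (intro order_trans[OF sum_abs] sum_mono) auto
    then have "\<bar>(\<Sum>t=a..<n. risk \<pi> l (h (t - b) \<omega>)) - (\<Sum>t=a..<n. paired_risk l X h b t \<omega>)
        + (\<Sum>t=a..<n. D t \<omega>)\<bar> \<le> real (n - a) * (5 / 8 * \<epsilon>)"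
      by (simp add: sum.distrib sum_subtractf)
    then have "\<bar>(\<Sum>t=a..<n. risk \<pi> l (h (t - b) \<omega>)) - (\<Sum>t=a..<n. paired_risk l X h b t \<omega>)\<bar>
        \<le> real (n - a) * (5 / 8 * \<epsilon>) + real (n - a) * (\<epsilon> / 4)"
      using D_sum by linarith
    also have "\<dots> = real (n - a) * (7 / 8 * \<epsilon>)" by (simp add: algebra_simps)
    finally have total: "\<bar>(\<Sum>t=a..<n. risk \<pi> l (h (t - b) \<omega>)) - (\<Sum>t=a..<n. paired_risk l X h b t \<omega>)\<bar>
        \<le> real (n - a) * (7 / 8 * \<epsilon>)" .
    have na: "real n - real a = real (n - a)" "0 < real (n - a)" using n by auto
    have eq: "1 / (real n - real a) * (\<Sum>t=a..<n. risk \<pi> l (h (t - b) \<omega>)) - avg_paired_risk l X h b a n \<omega>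
        = ((\<Sum>t=a..<n. risk \<pi> l (h (t - b) \<omega>)) - (\<Sum>t=a..<n. paired_risk l X h b t \<omega>)) / real (n - a)"
      unfolding avg_paired_risk_def na(1) by (simp add: diff_divide_distrib)
    have "\<epsilon> \<le> \<bar>(\<Sum>t=a..<n. risk \<pi> l (h (t - b) \<omega>)) - (\<Sum>t=a..<n. paired_risk l X h b t \<omega>)\<bar> / real (n - a)"
      using ge unfolding eq abs_divide abs_of_nat .
    also have "\<dots> \<le> real (n - a) * (7 / 8 * \<epsilon>) / real (n - a)"
      using total by (intro divide_right_mono) simp_all
    also have "\<dots> = 7 / 8 * \<epsilon>" using na(2) by (simp only: nonzero_mult_div_cancel_left less_irrefl)
    also have "\<dots> < \<epsilon>" using \<epsilon> by simp
    finally show False by simp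
  qed
  have "prob {\<omega> \<in> space M.
      \<bar>1 / (real n - real a) * (\<Sum>t=a..<n. risk \<pi> l (h (t - b) \<omega>)) - avg_paired_risk l X h b a n \<omega>\<bar> \<ge> \<epsilon>}
    \<le> prob (A1 \<union> A2 \<union> A3)"
    using A_sets by (intro finite_measure_mono[OF sub]) auto
  also have "\<dots> \<le> prob A1 + prob A2 + prob A3"
    using measure_Un_le[of "A1 \<union> A2" M A3] measure_Un_le[of A1 M A2] A_sets by simp
  finally show ?thesis using A1_prob A2_prob A3_prob unfolding B_def by linarith
qed

end

section \<open>The hypothesis class\<close>

lemma abs_diff_le_sup_dist:
  assumes "g \<in> bounded_funs E" "h \<in> bounded_funs E" "z \<in> E \<times> E"
  shows "\<bar>g z - h z\<bar> \<le> sup_dist E g h"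
proof -
  obtain a where a: "\<And>z. z \<in> E \<times> E \<Longrightarrow> \<bar>g z\<bar> \<le> a"
    using assms(1) unfolding bounded_funs_def bounded_iff by auto
  obtain b where b: "\<And>z. z \<in> E \<times> E \<Longrightarrow> \<bar>h z\<bar> \<le> b"
    using assms(2) unfolding bounded_funs_def bounded_iff by auto
  have "\<bar>g z - h z\<bar> \<le> a + b" if "z \<in> E \<times> E" for z
    using a[OF that] b[OF that] by linarith
  then have "bdd_above ((\<lambda>z. \<bar>g z - h z\<bar>) ` (E \<times> E))" by (intro bdd_aboveI2)
  from cSUP_upper[OF assms(3) this] show ?thesis using assms by (simp add: sup_dist_def)
qed

lemma space_hyp_borel: "space (hyp_borel E H) = H"
  by (simp add: hyp_borel_def space_measure_of_conv)

text \<open>Sublevel sets are traces of open balls on \<open>H\<close>, hence generators of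
  \<open>hyp_borel\<close>.\<close>

lemma sup_dist_measurable:
  assumes E: "E \<noteq> {}" and H: "H \<subseteq> bounded_funs E" and g: "g \<in> H"
  shows "sup_dist E g \<in> borel_measurable (hyp_borel E H)"
proof -
  interpret Metric_space "bounded_funs E" "sup_dist E" by (rule Metric_space_sup_dist[OF E])
  have pow: "{U. openin (subtopology (sup_topology E) H) U} \<subseteq> Pow H"
    using openin_subset[of "subtopology (sup_topology E) H"] by (auto simp: topspace_subtopology)
  show ?thesis
  proof (rule borel_measurable_iff_less[THEN iffD2], rule allI)
    fix r
    have "{h \<in> space (hyp_borel E H). sup_dist E g h < r} = mball g r \<inter> H"
      using g H by (auto simp: space_hyp_borel mball_def)
    moreover have "openin (subtopology (sup_topology E) H) (mball g r \<inter> H)"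
      unfolding sup_topology_def by (intro openin_subtopology_Int openin_mball)
    ultimately show "{h \<in> space (hyp_borel E H). sup_dist E g h < r} \<in> sets (hyp_borel E H)"
      unfolding hyp_borel_def using pow by (simp add: sigma_sets.Basic)
  qed
qed

lemma compact_finite_net:
  assumes E: "E \<noteq> {}" and H: "compactin (sup_topology E) H" and \<eta>: "0 < \<eta>"
  obtains G where "finite G" "G \<subseteq> H" "\<And>h. h \<in> H \<Longrightarrow> \<exists>g\<in>G. sup_dist E g h < \<eta>"
proof -
  interpret Metric_space "bounded_funs E" "sup_dist E" by (rule Metric_space_sup_dist[OF E])
  have "mtotally_bounded H"
    using H unfolding sup_topology_def by (rule compactin_imp_mtotally_bounded)
  from this[unfolded mtotally_bounded_def, rule_format, OF \<eta>]
  obtain G where G: "finite G" "G \<subseteq> H" "H \<subseteq> (\<Union>x\<in>G. mball x \<eta>)" by (elim exE conjE)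
  show thesis
  proof (rule that[OF G(1,2)])
    fix h assume "h \<in> H"
    then obtain g where "g \<in> G" "h \<in> mball g \<eta>" using G(3) by blast
    then show "\<exists>g\<in>G. sup_dist E g h < \<eta>" unfolding in_mball by blast
  qed
qed

lemma compact_bounded_funs:
  assumes "E \<noteq> {}" "compactin (sup_topology E) H"
  shows "H \<subseteq> bounded_funs E"
proof -
  interpret Metric_space "bounded_funs E" "sup_dist E" by (rule Metric_space_sup_dist[OF assms(1)])
  show ?thesis using compactin_subset_topspace[OF assms(2)] by (simp add: sup_topology_def)
qed

text \<open>An infimum of a nonempty set of natural numbers is attained, and nonemptiness is total
  boundedness. The radius may be infinite, hence the detour through a real \<open>r\<close> below
  it.\<close>

lemma covering_number_attained:
  assumes E: "E \<noteq> {}" and H: "compactin (sup_topology E) H" and \<eta>: "0 < \<eta>"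
  obtains G where "finite G" "G \<subseteq> H" "card G = covering_number E H \<eta>"
    "\<And>h. h \<in> H \<Longrightarrow> \<exists>g\<in>G. ereal (sup_dist E g h) \<le> \<eta>"
proof -
  let ?C = "{card G | G. finite G \<and> G \<subseteq> H \<and> (\<forall>h\<in>H. \<exists>g\<in>G. ereal (sup_dist E g h) \<le> \<eta>)}"
  obtain r where r: "0 < r" "ereal r \<le> \<eta>"
    using ereal_dense2[OF \<eta>] by (metis ereal_less(2) less_imp_le)
  obtain G where G: "finite G" "G \<subseteq> H" "\<And>h. h \<in> H \<Longrightarrow> \<exists>g\<in>G. sup_dist E g h < r"
    using compact_finite_net[OF E H r(1)] by metis
  have "\<exists>g\<in>G. ereal (sup_dist E g h) \<le> \<eta>" if "h \<in> H" for h
    using G(3)[OF that] r(2) by (metis ereal_less_eq(3) less_imp_le order_trans)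
  then have "card G \<in> ?C" using G by blast
  then have "Inf ?C \<in> ?C" by (intro Inf_nat_def1) auto
  then show thesis unfolding covering_number_def[symmetric] using that by auto
qed

text \<open>The value at \<open>h\<close> of a Lipschitz function of \<open>h\<close> is the infimum, over a countable dense set
  of \<open>g\<close>, of its values at \<open>g\<close> plus a multiple of the distance from \<open>g\<close> to \<open>h\<close>; this makes the
  function jointly measurable.\<close>
lemma lipschitz_jointly_measurable:
  fixes l :: "('e \<times> 'e \<Rightarrow> real) \<Rightarrow> 'z \<Rightarrow> real"
  assumes E: "E \<noteq> {}" and H: "compactin (sup_topology E) H" "H \<noteq> {}"
    and h: "h \<in> F \<rightarrow>\<^sub>M hyp_borel E H"
    and l: "\<And>g. g \<in> H \<Longrightarrow> l g \<in> borel_measurable N"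
    and l0: "\<And>g z. 0 \<le> l g z"
    and lip: "\<And>g g' z. g \<in> H \<Longrightarrow> g' \<in> H \<Longrightarrow> z \<in> space N \<Longrightarrow> \<bar>l g z - l g' z\<bar> \<le> K * sup_dist E g g'"
    and K: "0 \<le> K"
  shows "(\<lambda>(\<omega>, z). l (h \<omega>) z) \<in> borel_measurable (F \<Otimes>\<^sub>M N)"
proof -
  interpret Metric_space "bounded_funs E" "sup_dist E" by (rule Metric_space_sup_dist[OF E])
  note bounded = compact_bounded_funs[OF E H(1)]
  have "\<exists>G. finite G \<and> G \<subseteq> H \<and> (\<forall>h\<in>H. \<exists>g\<in>G. sup_dist E g h < 1 / real (Suc i))" for i
  proof -
    have "0 < 1 / real (Suc i)" by simp
    from compact_finite_net[OF E H(1) this] show ?thesis by metis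
  qed
  then have "\<forall>i. \<exists>G. finite G \<and> G \<subseteq> H \<and> (\<forall>h\<in>H. \<exists>g\<in>G. sup_dist E g h < 1 / real (Suc i))" ..
  from choice[OF this] obtain G where G: "\<And>i. finite (G i)" "\<And>i. G i \<subseteq> H"
    "\<And>i h. h \<in> H \<Longrightarrow> \<exists>g\<in>G i. sup_dist E g h < 1 / real (Suc i)" by metis
  define D where "D = (\<Union>i. G i)"
  have "countable D"
    unfolding D_def by (rule countable_UN) (auto intro: countable_finite G)
  moreover have "D \<subseteq> H"
    unfolding D_def using G(2) by (rule UN_least)
  moreover have "D \<noteq> {}"
  proof -
    obtain h where "h \<in> H" using H(2) by blast
    from G(3)[OF this, of 0] show ?thesis unfolding D_def by blast
  qed
  ultimately have D: "countable D" "D \<subseteq> H" "D \<noteq> {}" by simp_all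
  have hH: "h \<omega> \<in> H" if "\<omega> \<in> space F" for \<omega>
    using measurable_space[OF h that] by (simp add: space_hyp_borel)
  have eq: "l (h \<omega>) z = (INF g\<in>D. l g z + K * sup_dist E g (h \<omega>))"
    if \<omega>: "\<omega> \<in> space F" and z: "z \<in> space N" for \<omega> z
  proof (rule antisym)
    show "l (h \<omega>) z \<le> (INF g\<in>D. l g z + K * sup_dist E g (h \<omega>))"
    proof (rule cINF_greatest[OF D(3)])
      fix g assume "g \<in> D"
      then show "l (h \<omega>) z \<le> l g z + K * sup_dist E g (h \<omega>)"
        using lip[OF _ hH[OF \<omega>] z, of g] D(2) by auto
    qed
    show "(INF g\<in>D. l g z + K * sup_dist E g (h \<omega>)) \<le> l (h \<omega>) z"
    proof (rule field_le_epsilon)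
      fix e :: real assume e: "0 < e"
      \<comment> \<open>\<open>l g z\<close> may exceed \<open>l (h \<omega>) z\<close> by
        \<open>K\<close> times the distance and the penalty adds the same again, hence
        \<open>2 * K\<close>; the extra 1 keeps the denominator positive when
        \<open>K = 0\<close>.\<close>
      then obtain i where i: "inverse (real (Suc i)) < e / (2 * K + 1)"
        using reals_Archimedean[of "e / (2 * K + 1)"] K by auto
      obtain g where g: "g \<in> G i" "sup_dist E g (h \<omega>) < 1 / real (Suc i)"
        using G(3)[OF hH[OF \<omega>]] by blast
      have gD: "g \<in> D" using g by (auto simp: D_def)
      have "(2 * K + 1) * sup_dist E g (h \<omega>) \<le> e"
      proof -
        have "sup_dist E g (h \<omega>) \<le> e / (2 * K + 1)" using g(2) i by (simp add: inverse_eq_divide)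
        then show ?thesis using K by (simp add: field_simps)
      qed
      then have "2 * (K * sup_dist E g (h \<omega>)) + sup_dist E g (h \<omega>) \<le> e"
        by (simp add: algebra_simps)
      then have 2: "2 * (K * sup_dist E g (h \<omega>)) \<le> e"
        using nonneg[of g "h \<omega>"] by linarith
      have "(INF g\<in>D. l g z + K * sup_dist E g (h \<omega>)) \<le> l g z + K * sup_dist E g (h \<omega>)"
        by (rule cINF_lower[OF bdd_belowI2[of _ 0] gD]) (use l0 K in auto)
      also have "l g z \<le> l (h \<omega>) z + K * sup_dist E g (h \<omega>)"
        using lip[OF _ hH[OF \<omega>] z, of g] gD D(2) by auto
      finally show "(INF g\<in>D. l g z + K * sup_dist E g (h \<omega>)) \<le> l (h \<omega>) z + e"
        using 2 by linarith
    qed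
  qed
  have "(\<lambda>x. INF g\<in>D. l g (snd x) + K * sup_dist E g (h (fst x))) \<in> borel_measurable (F \<Otimes>\<^sub>M N)"
  proof (rule borel_measurable_cINF[OF D(1)])
    fix g assume g: "g \<in> D"
    have "(\<lambda>x. l g (snd x)) \<in> borel_measurable (F \<Otimes>\<^sub>M N)"
      using g D(2) by (intro measurable_compose[OF measurable_snd] l) auto
    moreover have "(\<lambda>x. sup_dist E g (h (fst x))) \<in> borel_measurable (F \<Otimes>\<^sub>M N)"
      using g D(2) by (intro measurable_compose[OF measurable_fst] measurable_compose[OF h]
          sup_dist_measurable E bounded) auto
    ultimately show "(\<lambda>x. l g (snd x) + K * sup_dist E g (h (fst x))) \<in> borel_measurable (F \<Otimes>\<^sub>M N)"
      by measurable
  next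
    show "bdd_below ((\<lambda>g. l g (snd x) + K * sup_dist E g (h (fst x))) ` D)" for x
      by (rule bdd_belowI2[of _ 0]) (use l0 K in auto)
  qed
  moreover have "(\<lambda>(\<omega>, z). l (h \<omega>) z) x = (INF g\<in>D. l g (snd x) + K * sup_dist E g (h (fst x)))"
    if "x \<in> space (F \<Otimes>\<^sub>M N)" for x
    using eq that by (auto simp: space_pair_measure)
  ultimately show ?thesis by (subst measurable_cong) auto
qed

section \<open>Lipschitz losses and their covers\<close>

lemma lipschitz_snd_Lip:
  assumes "lipschitz_snd \<phi>"
  shows "0 \<le> Lip \<phi>" and "\<bar>\<phi> u v - \<phi> u w\<bar> \<le> Lip \<phi> * \<bar>v - w\<bar>"
proof -
  let ?K = "{K. \<forall>u. K-lipschitz_on UNIV (\<phi> u)}"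
  have ne: "?K \<noteq> {}" using assms by (auto simp: lipschitz_snd_def)
  show "0 \<le> Lip \<phi>"
    unfolding Lip_def by (rule cInf_greatest[OF ne]) (auto dest: lipschitz_on_nonneg)
  show "\<bar>\<phi> u v - \<phi> u w\<bar> \<le> Lip \<phi> * \<bar>v - w\<bar>"
  proof (cases "v = w")
    case False
    \<comment> \<open>Each difference quotient is below every admissible constant, hence below their
      infimum: \<open>Lip \<phi>\<close> is itself admissible.\<close>
    have "\<bar>\<phi> u v - \<phi> u w\<bar> / \<bar>v - w\<bar> \<le> Lip \<phi>"
      unfolding Lip_def
    proof (rule cInf_greatest[OF ne])
      fix K assume "K \<in> ?K"
      then have "dist (\<phi> u v) (\<phi> u w) \<le> K * dist v w"
        by (auto intro: lipschitz_onD)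
      then show "\<bar>\<phi> u v - \<phi> u w\<bar> / \<bar>v - w\<bar> \<le> K"
        using False by (simp add: dist_real_def divide_simps)
    qed
    then show ?thesis using False by (simp add: divide_simps)
  qed simp
qed

lemma pair_loss_lipschitz:
  assumes "lipschitz_snd \<phi>" "g \<in> bounded_funs E" "h \<in> bounded_funs E" "x \<in> E" "y \<in> E"
  shows "\<bar>pair_loss \<phi> f g x y - pair_loss \<phi> f h x y\<bar> \<le> Lip \<phi> * sup_dist E g h"
proof -
  have "\<bar>pair_loss \<phi> f g x y - pair_loss \<phi> f h x y\<bar> \<le> Lip \<phi> * \<bar>g (x, y) - h (x, y)\<bar>"
    unfolding pair_loss_def by (rule lipschitz_snd_Lip(2)[OF assms(1)])
  also have "\<dots> \<le> Lip \<phi> * sup_dist E g h"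
    using assms by (intro mult_left_mono abs_diff_le_sup_dist lipschitz_snd_Lip(1)) auto
  finally show ?thesis .
qed

lemma pair_loss_cover:
  assumes "lipschitz_snd \<phi>" "E \<noteq> {}" "compactin (sup_topology E) H" "0 < \<epsilon>"
  obtains G where "finite G" "G \<subseteq> H"
    "card G = covering_number E H (ereal \<epsilon> / ereal (8 * Lip \<phi>))"
    "\<And>h. h \<in> H \<Longrightarrow> \<exists>g\<in>G. \<forall>x\<in>E. \<forall>y\<in>E.
       \<bar>pair_loss \<phi> f g x y - pair_loss \<phi> f h x y\<bar> \<le> \<epsilon> / 8"
proof -
  note Lip0 = lipschitz_snd_Lip(1)[OF assms(1)]
  note bounded = compact_bounded_funs[OF assms(2,3)]
  \<comment> \<open>For \<open>Lip \<phi> = 0\<close> the radius is infinite, hence still positive;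
    the loss then does not vary with the hypothesis.\<close>
  have "0 < ereal \<epsilon> / ereal (8 * Lip \<phi>)"
    using Lip0 assms(4) by (cases "Lip \<phi> = 0") (auto simp: divide_ereal_def)
  then obtain G where G: "finite G" "G \<subseteq> H" "card G = covering_number E H (ereal \<epsilon> / ereal (8 * Lip \<phi>))"
    "\<And>h. h \<in> H \<Longrightarrow> \<exists>g\<in>G. ereal (sup_dist E g h) \<le> ereal \<epsilon> / ereal (8 * Lip \<phi>)"
    using covering_number_attained[OF assms(2,3)] by metis
  have "\<exists>g\<in>G. \<forall>x\<in>E. \<forall>y\<in>E. \<bar>pair_loss \<phi> f g x y - pair_loss \<phi> f h x y\<bar> \<le> \<epsilon> / 8" if h: "h \<in> H" for h
  proof -
    obtain g where g: "g \<in> G" "ereal (sup_dist E g h) \<le> ereal \<epsilon> / ereal (8 * Lip \<phi>)"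
      using G(4)[OF h] by blast
    have le: "Lip \<phi> * sup_dist E g h \<le> \<epsilon> / 8"
    proof (cases "Lip \<phi> = 0")
      case False
      then have "0 < Lip \<phi>" using Lip0 by simp
      then have "sup_dist E g h \<le> \<epsilon> / (8 * Lip \<phi>)" using g(2) by simp
      then show ?thesis using \<open>0 < Lip \<phi>\<close> by (simp add: field_simps)
    qed (use assms(4) in simp)
    have "\<bar>pair_loss \<phi> f g x y - pair_loss \<phi> f h x y\<bar> \<le> \<epsilon> / 8" if "x \<in> E" "y \<in> E" for x y
      using order_trans[OF pair_loss_lipschitz[OF assms(1) _ _ that] le] g(1) G(2) h bounded by blast
    then show ?thesis using g(1) by blast
  qed
  then show thesis using G(1-3) by (intro that)
qed

section \<open>Asymptotics of the sample sizes\<close>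

text \<open>\<open>q * ln x - 1\<close> and \<open>q * ln x\<close> enclose the lag,
  \<open>c * x\<close> and \<open>c * x + 1\<close> the start time, and \<open>d\<close> stands for
  \<open>1 - c\<close>. Each inequality takes the unfavourable side of every rounding, so that the
  integer versions follow by monotonicity.\<close>

lemma sample_size_asymptotics:
  fixes q c d \<kappa> C \<delta> K K' m :: real
  assumes "0 < q" "0 < c" "0 < d" "0 < \<kappa>" "0 < C" "0 < \<delta>" "0 < m" "0 < \<rho>" "0 < K'"
  shows "\<forall>\<^sub>F x::real in at_top. 1 \<le> q * ln x - 1"
    "\<forall>\<^sub>F x::real in at_top. q * ln x < c * x"
    "\<forall>\<^sub>F x::real in at_top. q * ln x + 1 \<le> d * x"
    "\<forall>\<^sub>F x::real in at_top. K \<le> c * x - q * ln x"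
    "\<forall>\<^sub>F x::real in at_top. ln x \<le> \<kappa> * (q * ln x - 1)\<^sup>2 - 1"
    "\<forall>\<^sub>F x::real in at_top. ln x + (c * x + 1) * C / (16 * (q * ln x - 1)\<^sup>2)
       \<le> \<delta> * ((c * x - q * ln x - 1) / m - 1)"
    "\<forall>\<^sub>F x::real in at_top. C * (c * x + 1) \<le> (q * ln x - 1) * (d * x - 1)"
    "\<forall>\<^sub>F x::real in at_top. (K' / (\<rho> * x))\<^sup>2 * (C * (c * x + 1)) \<le> 1"
  using assms by real_asymp+

text \<open>Without rounding, \<open>\<rho> ^ b\<close> would be \<open>n\<close> to the power
  \<open>- (\<xi> + 1)\<close>. The floor loses at most one step, hence the factor
  \<open>1 / \<rho>\<close>; the surplus \<xi> in the exponent is given away.\<close>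

lemma burn_in_bounds:
  assumes "0 < \<xi>" "0 < \<rho>" "\<rho> < 1" "1 \<le> n"
  defines "q \<equiv> (\<xi> + 1) / ln (1 / \<rho>)"
  shows "q * ln (real n) - 1 \<le> real (burn_in \<xi> \<rho> n)" "real (burn_in \<xi> \<rho> n) \<le> q * ln (real n)"
    and "\<rho> ^ burn_in \<xi> \<rho> n \<le> 1 / (\<rho> * real n)"
proof -
  have l: "0 < ln (1 / \<rho>)" using assms by (simp add: ln_div)
  have q: "0 < q" using l assms by (simp add: q_def)
  have ge0: "0 \<le> q * ln (real n)" using q assms by simp
  have eq: "real (burn_in \<xi> \<rho> n) = real_of_int \<lfloor>q * ln (real n)\<rfloor>"
    unfolding burn_in_def q_def[symmetric] using ge0 by simp
  show lower: "q * ln (real n) - 1 \<le> real (burn_in \<xi> \<rho> n)" unfolding eq by linarith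
  show "real (burn_in \<xi> \<rho> n) \<le> q * ln (real n)" unfolding eq by linarith
  have "\<rho> ^ burn_in \<xi> \<rho> n = exp (- (real (burn_in \<xi> \<rho> n) * ln (1 / \<rho>)))"
    using assms by (simp add: ln_div exp_of_nat_mult[symmetric] mult.commute flip: powr_realpow)
      (simp add: powr_def)
  also have "\<dots> \<le> exp (- ((q * ln (real n) - 1) * ln (1 / \<rho>)))"
    using lower l by (simp add: mult_right_mono)
  also have "(q * ln (real n) - 1) * ln (1 / \<rho>) = (\<xi> + 1) * ln (real n) + ln \<rho>"
    using l assms by (simp add: q_def left_diff_distrib ln_div field_simps)
  also have "exp (- \<dots>) \<le> exp (- (ln (real n) + ln \<rho>))"
    using assms by (simp add: distrib_right)
  also have "\<dots> = 1 / (\<rho> * real n)"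
    using assms by (simp add: exp_diff exp_minus inverse_eq_divide mult.commute)
  finally show "\<rho> ^ burn_in \<xi> \<rho> n \<le> 1 / (\<rho> * real n)" .
qed

lemma start_time_bounds:
  assumes "0 < c"
  shows "c * real n \<le> real (start_time c n)" "real (start_time c n) \<le> c * real n + 1"
  unfolding start_time_def using assms by (simp_all add: le_of_int_ceiling)

text \<open>With \<open>Z\<close> the exponent of the target bound, one may assume \<open>Z \<ge> 1\<close> since the target exceeds
  1 otherwise; the union bounds over \<open>n - a\<close> times are then absorbed because the lag \<open>b\<close> is of
  larger order than the square root of \<open>ln n\<close>.\<close>
lemma sum_of_tails_le:
  fixes n a b N m :: nat and \<epsilon> \<delta> C B :: real
  defines "Z \<equiv> (real a - real b) * C * \<epsilon>\<^sup>2 / (16 * (real b)\<^sup>2)"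
  assumes N: "1 \<le> N" and b: "1 \<le> b" "b < a" and n: "a < n" and \<epsilon>: "0 < \<epsilon>" "\<epsilon> \<le> 1"
    and C: "0 < C" and B: "0 < B" and \<delta>: "0 < \<delta>" "\<delta> \<le> 1" and m: "1 \<le> m" and Z: "1 \<le> Z"
    and h1: "ln (real n) \<le> 1 / (8 * B\<^sup>2 * C) * (real b)\<^sup>2 - 1"
    and h2: "ln (real n) + real a * C / (16 * (real b)\<^sup>2) \<le> \<delta> * ((real a - real b - 1) / real m - 1)"
    and h3: "C * real a \<le> real b * (real n - real a)"
  shows "real (n - a) * (real N * (2 * exp (- (\<epsilon>\<^sup>2 * real (a - b) / (128 * B\<^sup>2)))))
      + real (n - a) * (1 - \<delta>) ^ ((a - b - 1) div m)
      + real b * (2 * exp (- (\<epsilon>\<^sup>2 * real (n - a) / (16 * real b))))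
    \<le> 2 * (32 * real N + 1) * real b * exp (- Z)"
proof -
  have n_exp: "real (n - a) \<le> exp (ln (real n))" using n by simp
  have ab: "real (a - b) = real a - real b" using b by simp
  have lnn: "0 \<le> ln (real n)" using n by simp
  have bC: "0 < (real b)\<^sup>2" using b by simp
  have 1: "real (n - a) * exp (- (\<epsilon>\<^sup>2 * real (a - b) / (128 * B\<^sup>2))) \<le> exp (- Z)"
  proof -
    \<comment> \<open>The ratio of the concentration exponent to \<open>Z\<close>; the 8 is 128 /
      16.\<close>
    define \<kappa> where "\<kappa> = 1 / (8 * B\<^sup>2 * C) * (real b)\<^sup>2"
    have \<kappa>: "ln (real n) \<le> \<kappa> - 1" using h1 by (simp add: \<kappa>_def)
    have "\<epsilon>\<^sup>2 * real (a - b) / (128 * B\<^sup>2) = \<kappa> * Z"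
      using b B C by (simp add: Z_def ab \<kappa>_def field_simps)
    \<comment> \<open>The surplus \<open>\<kappa> - 1\<close> dominates \<open>ln n\<close>, and by
      \<open>Z \<ge> 1\<close> it may be multiplied by \<open>Z\<close>.\<close>
    moreover have "ln (real n) + Z \<le> \<kappa> * Z"
    proof -
      have "\<kappa> - 1 \<le> (\<kappa> - 1) * Z" using \<kappa> lnn Z by (simp add: mult_le_cancel_left1)
      then show ?thesis using \<kappa> by (simp add: algebra_simps)
    qed
    ultimately have "exp (ln (real n)) * exp (- (\<epsilon>\<^sup>2 * real (a - b) / (128 * B\<^sup>2))) \<le> exp (- Z)"
      unfolding exp_add[symmetric] by simp
    then show ?thesis using n_exp by (meson exp_ge_zero mult_right_mono order_trans)
  qed
  have 2: "real (n - a) * (1 - \<delta>) ^ ((a - b - 1) div m) \<le> exp (- Z)"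
  proof -
    let ?k = "(a - b - 1) div m"
    have "a - b - 1 < (?k + 1) * m"
      using m by (metis Suc_eq_plus1 dividend_less_div_times mult_Suc add.commute less_le_trans
          zero_less_one order_refl)
    then have "real (a - b - 1) < real ((?k + 1) * m)" by (simp only: of_nat_less_iff)
    \<comment> \<open>The rounding in \<open>div\<close> costs at most one block, the last
      \<open>- 1\<close> on the left.\<close>
    then have "(real a - real b - 1) / real m - 1 \<le> real ?k"
      using m b by (simp add: field_simps of_nat_diff)
    then have k: "\<delta> * ((real a - real b - 1) / real m - 1) \<le> \<delta> * real ?k"
      using \<delta> by (intro mult_left_mono) auto
    \<comment> \<open>The Doeblin term does not change with \<epsilon>, so \<open>Z\<close> is
      bounded through \<open>\<epsilon> \<le> 1\<close> by a quantity free of \<epsilon>, of order n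
      / (ln n)^2 against the linear growth in \<open>h2\<close>.\<close>
    have "Z \<le> real a * C / (16 * (real b)\<^sup>2)"
      unfolding Z_def
    proof (rule divide_right_mono)
      have "(real a - real b) * C * \<epsilon>\<^sup>2 \<le> (real a - real b) * C * 1"
        using \<epsilon> b C by (intro mult_left_mono) (auto simp: power_le_one)
      also have "\<dots> \<le> real a * C" using C by simp
      finally show "(real a - real b) * C * \<epsilon>\<^sup>2 \<le> real a * C" .
    qed simp
    then have "ln (real n) + Z \<le> \<delta> * real ?k" using h2 k by linarith
    moreover have "(1 - \<delta>) ^ ?k \<le> exp (- \<delta>) ^ ?k"
      using exp_ge_add_one_self[of "- \<delta>"] \<delta> by (intro power_mono) auto
    moreover have "exp (- \<delta>) ^ ?k = exp (- (\<delta> * real ?k))"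
      by (simp add: exp_of_nat_mult[symmetric] mult.commute)
    ultimately have "exp (ln (real n)) * (1 - \<delta>) ^ ?k \<le> exp (ln (real n)) * exp (- (ln (real n) + Z))"
      by (intro mult_left_mono) (auto intro: order_trans)
    also have "\<dots> = exp (- Z)" unfolding exp_add[symmetric] by simp
    finally show ?thesis
      using n_exp \<delta> by (meson diff_ge_0_iff_ge mult_right_mono order_trans zero_le_power)
  qed
  have 3: "exp (- (\<epsilon>\<^sup>2 * real (n - a) / (16 * real b))) \<le> exp (- Z)"
  proof -
    have "(real a - real b) * C * \<epsilon>\<^sup>2 \<le> (C * real a) * \<epsilon>\<^sup>2"
      using C by (intro mult_right_mono) (auto simp: algebra_simps)
    also have "\<dots> \<le> (real b * (real n - real a)) * \<epsilon>\<^sup>2" using h3 by (intro mult_right_mono) auto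
    finally have "Z \<le> (real b * (real n - real a)) * \<epsilon>\<^sup>2 / (16 * (real b)\<^sup>2)"
      unfolding Z_def by (rule divide_right_mono) simp
    also have "\<dots> = \<epsilon>\<^sup>2 * real (n - a) / (16 * real b)"
      using b n by (simp add: field_simps power2_eq_square of_nat_diff)
    finally show ?thesis by simp
  qed
  have "real (n - a) * (real N * (2 * exp (- (\<epsilon>\<^sup>2 * real (a - b) / (128 * B\<^sup>2))))) \<le> 2 * real N * exp (- Z)"
    using mult_left_mono[OF 1, of "2 * real N"] by (simp add: algebra_simps)
  moreover have "real b * (2 * exp (- (\<epsilon>\<^sup>2 * real (n - a) / (16 * real b)))) \<le> 2 * real b * exp (- Z)"
    using mult_left_mono[OF 3, of "2 * real b"] by simp
  \<comment> \<open>The innovation tail takes the summand \<open>2 * b\<close> of the prefactor; the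
    other two tails fit into \<open>64 * N * b\<close>.\<close>
  moreover have "2 * real N * exp (- Z) + exp (- Z) + 2 * real b * exp (- Z)
      \<le> 2 * (32 * real N + 1) * real b * exp (- Z)"
  proof -
    have "1 \<le> real N" "1 \<le> real b" using N b by auto
    then have "real N * 1 \<le> real N * real b" by (intro mult_left_mono) auto
    moreover have "2 * (32 * real N + 1) * real b = 64 * (real N * real b) + 2 * real b"
      by (simp add: algebra_simps)
    ultimately have "2 * real N + 1 + 2 * real b \<le> 2 * (32 * real N + 1) * real b"
      using \<open>1 \<le> real N\<close> by linarith
    from mult_right_mono[OF this, of "exp (- Z)"] show ?thesis by (simp add: algebra_simps)
  qed
  ultimately show ?thesis using 2 by linarith
qed

text \<open>\<open>K\<close> is the size of \<open>a - b\<close> that absorbs the boundary terms of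
  the Poisson decomposition. \<open>K'\<close> is for the lag error, whose square is O(1/n^2)
  against a factor of order n.\<close>

lemma eventually_sample_size:
  fixes \<xi> \<rho> c \<kappa> C \<delta> K K' :: real and m :: nat
  assumes \<xi>: "0 < \<xi>" and \<rho>: "0 < \<rho>" "\<rho> < 1" and c: "0 < c" "c < 1"
    and pos: "0 < \<kappa>" "0 < C" "0 < \<delta>" "0 < K'" "1 \<le> m"
  shows "\<forall>\<^sub>F n in sequentially. \<forall>a b. a = start_time c n \<longrightarrow> b = burn_in \<xi> \<rho> n \<longrightarrow>
    1 \<le> b \<and> b < a \<and> a < n \<and> b \<le> n - a \<and> K \<le> real a - real b \<and>
    ln (real n) \<le> \<kappa> * (real b)\<^sup>2 - 1 \<and>
    ln (real n) + real a * C / (16 * (real b)\<^sup>2) \<le> \<delta> * ((real a - real b - 1) / real m - 1) \<and>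
    C * real a \<le> real b * (real n - real a) \<and>
    (K' * \<rho> ^ b)\<^sup>2 * (C * real a) \<le> 1"
proof -
  define q where "q = (\<xi> + 1) / ln (1 / \<rho>)"
  have "0 < ln (1 / \<rho>)" using \<rho> by (simp add: ln_div)
  then have q: "0 < q" using \<xi> by (simp add: q_def)
  have m: "0 < real m" and d: "0 < 1 - c" using pos c by auto
  note asymp = sample_size_asymptotics[OF q c(1) d pos(1-3) m \<rho>(1) pos(4)]
  note seq = asymp(1-3) asymp(4)[where K=K] asymp(5-8)
  note seq = seq[THEN eventually_compose_filterlim, OF filterlim_real_sequentially]
  show ?thesis
    using seq eventually_ge_at_top[of 1]
  proof eventually_elim
    case (elim n)
    show ?case
    proof (intro allI impI)
      fix a b assume a_def: "a = start_time c n" and b_def: "b = burn_in \<xi> \<rho> n"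
      let ?L = "q * ln (real n)"
      have b: "?L - 1 \<le> real b" "real b \<le> ?L" "\<rho> ^ b \<le> 1 / (\<rho> * real n)"
        unfolding b_def q_def by (rule burn_in_bounds[OF \<xi> \<rho> elim(9)])+
      have a: "c * real n \<le> real a" "real a \<le> c * real n + 1"
        unfolding a_def by (rule start_time_bounds[OF c(1)])+
      have b1: "1 \<le> b" using elim(1) b(1) by linarith
      have ba: "b < a" using elim(2) b(2) a(1) by linarith
      have "real a + real b \<le> real n" using elim(3) b(2) a(2) by (simp add: left_diff_distrib)
      then have ban: "b \<le> n - a" by linarith
      then have an: "a < n" using b1 by linarith
      have b2: "(?L - 1)\<^sup>2 \<le> (real b)\<^sup>2" using elim(1) b(1) by (intro power_mono) auto
      have L2: "0 < (?L - 1)\<^sup>2" using elim(1) by simp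
      have 1: "K \<le> real a - real b" using elim(4) b(2) a(1) by linarith
      have 2: "ln (real n) \<le> \<kappa> * (real b)\<^sup>2 - 1"
        using elim(5) mult_left_mono[OF b2, of \<kappa>] pos by linarith
      have 3: "ln (real n) + real a * C / (16 * (real b)\<^sup>2) \<le> \<delta> * ((real a - real b - 1) / real m - 1)"
      proof -
        have "real a * C / (16 * (real b)\<^sup>2) \<le> (c * real n + 1) * C / (16 * (?L - 1)\<^sup>2)"
          using a b2 L2 pos c by (intro frac_le mult_right_mono) auto
        moreover have "\<delta> * ((c * real n - ?L - 1) / real m - 1) \<le> \<delta> * ((real a - real b - 1) / real m - 1)"
          using a b pos by (intro mult_left_mono diff_mono divide_right_mono) auto
        ultimately show ?thesis using elim(6) by linarith
      qed
      have 4: "C * real a \<le> real b * (real n - real a)"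
      proof -
        have "C * real a \<le> C * (c * real n + 1)" using a pos by (intro mult_left_mono) auto
        also have "\<dots> \<le> (?L - 1) * ((1 - c) * real n - 1)" by (rule elim(7))
        also have "\<dots> \<le> real b * (real n - real a)"
          using b(1) a(2) elim(1,3) by (intro mult_mono) (auto simp: left_diff_distrib)
        finally show ?thesis .
      qed
      have 5: "(K' * \<rho> ^ b)\<^sup>2 * (C * real a) \<le> 1"
      proof -
        have "K' * \<rho> ^ b \<le> K' * (1 / (\<rho> * real n))" using b(3) pos by (intro mult_left_mono) auto
        then have "(K' * \<rho> ^ b)\<^sup>2 \<le> (K' / (\<rho> * real n))\<^sup>2"
          using pos \<rho> by (intro power_mono) auto
        then have "(K' * \<rho> ^ b)\<^sup>2 * (C * real a) \<le> (K' / (\<rho> * real n))\<^sup>2 * (C * (c * real n + 1))"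
          using a pos by (intro mult_mono) auto
        then show ?thesis using elim(8) by linarith
      qed
      show "1 \<le> b \<and> b < a \<and> a < n \<and> b \<le> n - a \<and> K \<le> real a - real b \<and>
        ln (real n) \<le> \<kappa> * (real b)\<^sup>2 - 1 \<and>
        ln (real n) + real a * C / (16 * (real b)\<^sup>2) \<le> \<delta> * ((real a - real b - 1) / real m - 1) \<and>
        C * real a \<le> real b * (real n - real a) \<and>
        (K' * \<rho> ^ b)\<^sup>2 * (C * real a) \<le> 1"
        by (intro conjI b1 ba an ban 1 2 3 4 5)
    qed
  qed
qed

section \<open>Ranges of risks and averages, and the final assembly\<close>

lemma risk_bounds:
  assumes "\<pi> \<in> space (prob_algebra S)" "(\<lambda>(x, x'). l g x x') \<in> borel_measurable (S \<Otimes>\<^sub>M S)"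
    and "\<And>x y. l g x y \<in> {0..1}"
  shows "risk \<pi> l g \<in> {0..1}"
proof -
  interpret prob_space \<pi> using assms(1) by (simp add: space_prob_algebra)
  interpret pair_prob_space \<pi> \<pi> ..
  have "sets \<pi> = sets S" using assms(1) by (simp add: space_prob_algebra)
  then have "\<pi> \<Otimes>\<^sub>M \<pi> \<in> space (prob_algebra (S \<Otimes>\<^sub>M S))"
    using P.prob_space_axioms by (simp add: space_prob_algebra cong: sets_pair_measure_cong)
  from integrable_bounded_prob(2)[OF this assms(2)] show ?thesis
    unfolding risk_def using assms(3) by auto
qed

lemma average_bounds:
  fixes x :: "nat \<Rightarrow> real"
  assumes "finite I" "\<And>i. i \<in> I \<Longrightarrow> x i \<in> {0..1}"
  shows "1 / real (card I) * sum x I \<in> {0..1}"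
proof -
  have "0 \<le> sum x I" using assms by (intro sum_nonneg) auto
  moreover have "sum x I \<le> real (card I)"
    using sum_mono[of I x "\<lambda>_. 1"] assms by auto
  \<comment> \<open>For empty \<open>I\<close> the quotient \<open>1 / 0\<close> is 0, which lies in
    the interval as well; this occurs for a paired risk without past observations.\<close>
  ultimately show ?thesis using assms(1) by (cases "card I = 0") (auto simp: divide_simps)
qed

theorem theorem3:
  fixes M :: "'w measure" and M' :: "'v measure"
    and S \<mu> \<pi> :: "'e measure" and P :: "'e \<Rightarrow> 'e measure"
    and X :: "nat \<Rightarrow> 'w \<Rightarrow> 'e"
    and X' :: "nat \<Rightarrow> 'v \<Rightarrow> 'e" and R :: "nat \<Rightarrow> 'v \<Rightarrow> bool"
    and m :: nat and \<delta> \<tau> \<rho> \<xi> c :: real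
    and H :: "('e \<times> 'e \<Rightarrow> real) set"
    and f :: "'e \<Rightarrow> real" and \<phi> :: "real \<Rightarrow> real \<Rightarrow> real"
    and h :: "nat \<Rightarrow> nat \<Rightarrow> 'w \<Rightarrow> 'e \<times> 'e \<Rightarrow> real"
    and \<epsilon> :: "nat \<Rightarrow> real"
  assumes chain: "markov_chain M S P X"
    and ergodic: "uniformly_ergodic S P m \<delta> \<mu>"
    and stationary: "stationary_distribution S P \<pi>"
    and reversible: "reversible_kernel S P \<pi>"
    and rate: "ergodicity_rate S P \<pi> \<rho>"
    and split: "split_chain M' S P m \<delta> \<mu> (path_law M S X) X' R"
    and tau_pos: "0 < \<tau>"
    and tau: "max (psi1_norm M' (\<lambda>\<omega>. real (regen_time (\<lambda>k. R k \<omega>) 1)))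
                  (psi1_norm M' (\<lambda>\<omega>. real (regen_time (\<lambda>k. R k \<omega>) 2))) \<le> ereal \<tau>"
    and compact_H: "compactin (sup_topology (space S)) H"
    and phi_range: "\<And>u v. \<phi> u v \<in> {0..1}"
    and phi_lipschitz: "lipschitz_snd \<phi>"
    and loss_measurable: "\<And>g. g \<in> H \<Longrightarrow>
      (\<lambda>(x, x'). pair_loss \<phi> f g x x') \<in> borel_measurable (S \<Otimes>\<^sub>M S)"
    and online: "\<And>n. online_hypotheses M S X H n (h n)"
    and xi: "0 < \<xi>"
    and c: "c \<in> {0<..<1}"
    and eps_pos: "\<And>n. 0 < \<epsilon> n"
    and eps_small: "\<epsilon> \<in> o(\<lambda>n. real n powr \<xi>)"
  shows "\<forall>\<^sub>F n in sequentially.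
    (let b = burn_in \<xi> \<rho> n; a = start_time c n in
      measure M {\<omega> \<in> space M.
          \<bar>1 / (real n - real a) * (\<Sum>t=a..<n. risk \<pi> (pair_loss \<phi> f) (h n (t - b) \<omega>))
             - avg_paired_risk (pair_loss \<phi> f) X (h n) b a n \<omega>\<bar> \<ge> \<epsilon> n}
        \<le> 2 * (32 * real (covering_number (space S) H (ereal (\<epsilon> n) / ereal (8 * Lip \<phi>))) + 1)
            * real b
            * exp (- ((real a - real b) * rate_const m \<tau> * (\<epsilon> n)\<^sup>2 / (16 * (real b)\<^sup>2))))"
proof -
  interpret observed_chain M S P X by unfold_locales (fact chain)
  interpret ergodic_chain M S P X m \<delta> \<mu> \<pi> by unfold_locales (fact ergodic stationary)+
  let ?l = "pair_loss \<phi> f" and ?C = "rate_const m \<tau>"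
  define B where "B = real m / \<delta>"
  have B: "0 < B" using m_pos \<delta>_pos by (simp add: B_def)
  have C: "0 < ?C" using m_pos tau_pos by (simp add: rate_const_def)
  have \<rho>: "0 < \<rho>" "\<rho> < 1" using rate by (auto simp: ergodicity_rate_def)
  have c': "0 < c" "c < 1" using c by auto
  have sets\<pi>: "sets \<pi> = sets S" using \<pi> by (simp add: space_prob_algebra)
  have space\<pi>: "space \<pi> = space S" using sets_eq_imp_space_eq[OF sets\<pi>] .
  obtain L where L: "0 < L" and AE_rate: "AE x in \<pi>. \<forall>n. \<forall>A\<in>sets S.
      \<bar>measure (kernel_pow S P n x) A - measure \<pi> A\<bar> \<le> L * \<rho> ^ n"
    using rate by (auto simp: ergodicity_rate_def)
  \<comment> \<open>One null set serves all \<open>n\<close> and \<open>A\<close>, because these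
    quantifiers stand inside the almost sure statement.\<close>
  obtain N where N: "N \<in> null_sets \<pi>" and N_rate: "\<And>x n A. x \<in> space S \<Longrightarrow> x \<notin> N \<Longrightarrow> A \<in> sets S \<Longrightarrow>
      \<bar>measure (kernel_pow S P n x) A - measure \<pi> A\<bar> \<le> L * \<rho> ^ n"
    using AE_E3[OF AE_rate] unfolding space\<pi> by (metis DiffI)

  have l01: "?l g x y \<in> {0..1}" for g x y unfolding pair_loss_def by (rule phi_range)
  have h_past: "h n t \<in> past M S X t \<rightarrow>\<^sub>M hyp_borel (space S) H" if "t \<le> n" for n t
    using online[of n] that by (simp add: online_hypotheses_def)
  have hH: "h n t \<omega> \<in> H" if "t \<le> n" "\<omega> \<in> space M" for n t \<omega>
    using measurable_space[OF h_past[OF that(1)], of \<omega>] that(2) by (simp add: space_hyp_borel)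
  obtain \<omega>0 where "\<omega>0 \<in> space M" using not_empty by blast
  \<comment> \<open>The algorithm has to select something. Nonemptiness makes the covering number at
    least 1 and provides the dense set in \<open>lipschitz_jointly_measurable\<close>.\<close>
  then have H_ne: "H \<noteq> {}" using hH[of 0 0 \<omega>0] by auto
  note H_bounded = compact_bounded_funs[OF space_nonempty compact_H]
  have hm: "(\<lambda>(\<omega>, x, x'). ?l (h n t \<omega>) x x') \<in> borel_measurable (past M S X t \<Otimes>\<^sub>M (S \<Otimes>\<^sub>M S))"
    if "t \<le> n" for n t
  proof -
    have "(\<lambda>(\<omega>, z). ?l (h n t \<omega>) (fst z) (snd z)) \<in> borel_measurable (past M S X t \<Otimes>\<^sub>M (S \<Otimes>\<^sub>M S))"
    proof (rule lipschitz_jointly_measurable[OF space_nonempty compact_H H_ne h_past[OF that],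
          where l="\<lambda>g z. ?l g (fst z) (snd z)" and K="Lip \<phi>"])
      show "(\<lambda>z. ?l g (fst z) (snd z)) \<in> borel_measurable (S \<Otimes>\<^sub>M S)" if "g \<in> H" for g
        using loss_measurable[OF that] by (simp add: split_beta')
      show "\<bar>?l g (fst z) (snd z) - ?l g' (fst z) (snd z)\<bar> \<le> Lip \<phi> * sup_dist (space S) g g'"
        if "g \<in> H" "g' \<in> H" "z \<in> space (S \<Otimes>\<^sub>M S)" for g g' z
        using that H_bounded
        by (intro pair_loss_lipschitz[OF phi_lipschitz]) (auto simp: space_pair_measure)
    qed (use l01 lipschitz_snd_Lip(1)[OF phi_lipschitz] in auto)
    then show ?thesis by (simp add: split_beta')
  qed

  have \<kappa>: "0 < 1 / (8 * B\<^sup>2 * ?C)" using B C by simp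
  have L8: "0 < 8 * L" using L by simp
  show ?thesis
    \<comment> \<open>\<open>Z \<ge> 1\<close> makes \<open>((a - b) * e)\<^sup>2\<close> at least
      \<open>16 * (a - b) / C\<close>; the value of \<open>K\<close> lifts this to
      \<open>(8 * (2 * B + 1))\<^sup>2\<close>, as \<open>large'\<close> needs. The choice
      \<open>8 * L\<close> for \<open>K'\<close> matches a lag error of at most e / 8.\<close>
    using eventually_sample_size[OF xi \<rho> c' \<kappa> C \<delta>_pos L8 m_pos, where K="?C * (8 * (2 * B + 1))\<^sup>2 / 16"]
  proof eventually_elim
    case (elim n)
    define b where "b = burn_in \<xi> \<rho> n"
    define a where "a = start_time c n"
    define e where "e = \<epsilon> n"
    define Z where "Z = (real a - real b) * ?C * e\<^sup>2 / (16 * (real b)\<^sup>2)"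
    define Nc where "Nc = covering_number (space S) H (ereal e / ereal (8 * Lip \<phi>))"
    let ?A = "{\<omega> \<in> space M. \<bar>1 / (real n - real a) * (\<Sum>t=a..<n. risk \<pi> ?l (h n (t - b) \<omega>))
             - avg_paired_risk ?l X (h n) b a n \<omega>\<bar> \<ge> e}"
    from elim[rule_format, OF a_def b_def]
    have b: "1 \<le> b" "b < a" and n: "a < n" "b \<le> n - a"
      and large: "?C * (8 * (2 * B + 1))\<^sup>2 / 16 \<le> real a - real b"
      and h1: "ln (real n) \<le> 1 / (8 * B\<^sup>2 * ?C) * (real b)\<^sup>2 - 1"
      and h2: "ln (real n) + real a * ?C / (16 * (real b)\<^sup>2) \<le> \<delta> * ((real a - real b - 1) / real m - 1)"
      and h3: "?C * real a \<le> real b * (real n - real a)"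
      and h4: "(8 * L * \<rho> ^ b)\<^sup>2 * (?C * real a) \<le> 1" by blast+
    have e: "0 < e" by (simp add: e_def eps_pos)
    obtain G where G: "finite G" "G \<subseteq> H" "card G = Nc"
      and cover: "\<And>h. h \<in> H \<Longrightarrow>
        \<exists>g\<in>G. \<forall>x\<in>space S. \<forall>y\<in>space S. \<bar>?l g x y - ?l h x y\<bar> \<le> e / 8"
      using pair_loss_cover[OF phi_lipschitz space_nonempty compact_H e, of f] unfolding Nc_def by metis
    have "G \<noteq> {}" using H_ne cover by blast
    then have N1: "1 \<le> Nc" using G card_gt_0_iff[of G] by linarith
    have b2: "1 \<le> (real b)\<^sup>2" using b by simp
    have ab: "0 < real a - real b" using b by simp

    have "measure M ?A \<le> 2 * (32 * real Nc + 1) * real b * exp (- Z)"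
    proof -
      \<comment> \<open>A deviation above 1 is impossible, as both averages lie between 0 and 1, and
        for \<open>Z < 1\<close> the right-hand side exceeds 1. The remaining case has the lower
        bound on \<open>e\<close> on which \<open>large'\<close> and \<open>L_small\<close>
        rest.\<close>
      consider "1 < e" | "Z < 1" | "e \<le> 1" "1 \<le> Z" by linarith
      then show ?thesis
      proof cases
        case 1
        have "?A = {}"
        proof (rule equals0I)
          fix \<omega> assume "\<omega> \<in> ?A"
          then have \<omega>: "\<omega> \<in> space M" and ge: "e \<le> \<bar>1 / (real n - real a) * (\<Sum>t=a..<n. risk \<pi> ?l (h n (t - b) \<omega>))
             - avg_paired_risk ?l X (h n) b a n \<omega>\<bar>" by auto
          have na: "real n - real a = real (card {a..<n})" using n by simp
          have "1 / real (card {a..<n}) * (\<Sum>t=a..<n. risk \<pi> ?l (h n (t - b) \<omega>)) \<in> {0..1}"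
            by (intro average_bounds risk_bounds[OF \<pi>] loss_measurable hH \<omega> l01) auto
          moreover have "1 / real (card {a..<n}) * (\<Sum>t=a..<n. paired_risk ?l X (h n) b t \<omega>) \<in> {0..1}"
          proof (intro average_bounds)
            show "paired_risk ?l X (h n) b t \<omega> \<in> {0..1}" for t
              using average_bounds[of "{1..t-b}" "\<lambda>i. ?l (h n (t - b) \<omega>) (X t \<omega>) (X i \<omega>)"] l01
              by (simp add: paired_risk_def)
          qed simp
          ultimately show False using ge 1 unfolding avg_paired_risk_def na atLeastAtMost_iff by linarith
        qed
        then show ?thesis by (simp only: measure_empty) simp
      next
        case 2
        \<comment> \<open>66 is \<open>2 * (32 * 1 + 1)\<close>, the least value of the prefactor,
          for a cover with one element and \<open>b = 1\<close>.\<close>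
        have "1 \<le> 66 * exp (- 1 :: real)" using exp_le by (simp add: exp_minus divide_simps)
        also have "\<dots> \<le> 66 * exp (- Z)" using 2 by simp
        also have "\<dots> \<le> 2 * (32 * real Nc + 1) * real b * exp (- Z)"
        proof (rule mult_right_mono)
          have "66 * 1 \<le> 2 * (32 * real Nc + 1) * real b"
            using N1 b by (intro mult_mono) auto
          then show "66 \<le> 2 * (32 * real Nc + 1) * real b" by simp
        qed simp
        finally show ?thesis using prob_le_1[of ?A] by linarith
      next
        case 3
        have Z: "16 * (real b)\<^sup>2 \<le> (real a - real b) * ?C * e\<^sup>2"
          using 3(2) b by (simp add: Z_def divide_simps)
        have large': "2 * (real m / \<delta>) + 1 \<le> (real a - real b) * e / 8"
        proof -
          have "(8 * (2 * B + 1))\<^sup>2 \<le> ((real a - real b) * e)\<^sup>2"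
          proof -
            have "?C * (8 * (2 * B + 1))\<^sup>2 \<le> (real a - real b) * (16 * 1)"
              using mult_right_mono[OF large, of 16] by simp
            also have "\<dots> \<le> (real a - real b) * (16 * (real b)\<^sup>2)"
              using b2 ab by (intro mult_left_mono) auto
            also have "\<dots> \<le> (real a - real b) * ((real a - real b) * ?C * e\<^sup>2)"
              using Z ab by (intro mult_left_mono) auto
            also have "\<dots> = ?C * ((real a - real b) * e)\<^sup>2" by (simp add: power2_eq_square)
            finally show ?thesis using C by simp
          qed
          then have "8 * (2 * B + 1) \<le> (real a - real b) * e"
            using ab e by (intro power2_le_imp_le[of "8 * (2 * B + 1)"]) auto
          then show ?thesis by (simp add: B_def)
        qed
        \<comment> \<open>\<open>Z \<ge> 1\<close> puts \<open>e\<^sup>2\<close> above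
          \<open>16 * b\<^sup>2 / (C * (a - b))\<close>, while \<open>h4\<close> keeps the square of
          \<open>8 * L * \<rho> ^ b\<close> below \<open>1 / (C * a)\<close>.\<close>
        have L_small: "L * \<rho> ^ b \<le> e / 8"
        proof -
          have "(8 * L * \<rho> ^ b)\<^sup>2 * (?C * (real a - real b)) \<le> (8 * L * \<rho> ^ b)\<^sup>2 * (?C * real a)"
            using C by (intro mult_left_mono) auto
          also have "\<dots> \<le> 16 * (real b)\<^sup>2" using h4 b2 by linarith
          also have "\<dots> \<le> e\<^sup>2 * (?C * (real a - real b))" using Z by (simp add: mult_ac)
          finally have "(8 * L * \<rho> ^ b)\<^sup>2 \<le> e\<^sup>2" using C ab by simp
          then have "8 * L * \<rho> ^ b \<le> e" using e by (intro power2_le_imp_le[of "8 * L * \<rho> ^ b"]) auto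
          then show ?thesis by simp
        qed
        have "measure M ?A \<le> real (n - a) * (real (card G) * (2 * exp (- (e\<^sup>2 * real (a - b) / (128 * (real m / \<delta>)\<^sup>2)))))
          + real (n - a) * (1 - \<delta>) ^ ((a - b - 1) div m)
          + real b * (2 * exp (- (e\<^sup>2 * real (n - a) / (16 * real b))))"
        proof (rule paired_risk_tail[OF l01 loss_measurable hH hm G(1,2) cover N _ b n e large'])
          show "\<bar>measure (kernel_pow S P b x) A - measure \<pi> A\<bar> \<le> e / 8"
            if "x \<in> space S" "x \<notin> N" "A \<in> sets S" for x A
            using N_rate[OF that, of b] L_small by linarith
        qed
        also have "\<dots> \<le> 2 * (32 * real Nc + 1) * real b * exp (- Z)"
          unfolding Z_def G(3) B_def[symmetric]
          by (rule sum_of_tails_le[OF N1 b n(1) e 3(1) C B \<delta>_pos \<delta>_le_1 m_pos 3(2)[unfolded Z_def] h1 h2 h3])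
        finally show ?thesis .
      qed
    qed
    then show ?case
      unfolding Let_def Z_def Nc_def a_def b_def e_def .
  qed
qed

end
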